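(* No set $K\in\mathcal{C}_2$ is rigid.
   Context: For $n\ge2$, $\mathcal{C}_n$ denotes the class of all closed convex subsets $K$ of hyperbolic $n$-space $\mathbb{H}^n$ with non-empty interior whose boundary $\partial K\subseteq\mathbb{H}^n$ is a union of pairwise disjoint hyperplanes (complete totally geodesic copies of $\mathbb{H}^{n-1}$; geodesic lines if $n=2$), with at least three such hyperplanes in $\partial K$. Such sets carry the restricted hyperbolic metric. A map $f\colon X\to Y$ between metric spaces is a quasi-isometry if there are constants $\lambda\ge1$, $k\ge0$ such that $\frac1\lambda d_X(x,x')-k\le d_Y(f(x),f(x'))\le\lambda d_X(x,x')+k$ for all $x,x'\in X$, and for each $y\in Y$ there is $x\in X$ with $d_Y(f(x),y)\le k$. Two maps $f,g\colon X\to Y$ have finite distance if $\sup_{x\in X}d_Y(f(x),g(x))<\infty$. A set $K\in\mathcal{C}_n$ is rigid if for every quasi-isometry $f\colon K\to K'$ to another set $K'\in\mathcal{C}_n$ (possibly $K'=K$) there exists an isometry $g$ of $\mathbb{H}^n$ such that $f$ and $g|_K$ have finite distance (as maps into $\mathbb{H}^n$). *)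

theory Defs
  imports "HOL-Analysis.Analysis"
begin

text \<open>
  The type \<open>'a hyperbolic_space\<close> is hyperbolic \<open>n\<close>-space for \<open>n = DIM('a)\<close>: the upper sheet
  of the unit hyperboloid in Minkowski space \<open>'a \<times> real\<close>, whose last coordinate is the timelike one.
\<close>

definition minkowski :: "'a::euclidean_space \<times> real \<Rightarrow> 'a \<times> real \<Rightarrow> real" where
  "minkowski u v = fst u \<bullet> fst v - snd u * snd v"

lemma minkowski_commute: "minkowski u v = minkowski v u"
  by (simp add: minkowski_def inner_commute mult.commute)

lemma minkowski_add_left: "minkowski (u + v) w = minkowski u w + minkowski v w"
  by (simp add: minkowski_def inner_add_left algebra_simps)

lemma minkowski_add_right: "minkowski w (u + v) = minkowski w u + minkowski w v"
  by (simp add: minkowski_def inner_add_right algebra_simps)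

lemma minkowski_diff_left: "minkowski (u - v) w = minkowski u w - minkowski v w"
  by (simp add: minkowski_def inner_diff_left algebra_simps)

lemma minkowski_diff_right: "minkowski w (u - v) = minkowski w u - minkowski w v"
  by (simp add: minkowski_def inner_diff_right algebra_simps)

lemma minkowski_scaleR_left: "minkowski (c *\<^sub>R u) v = c * minkowski u v"
  by (simp add: minkowski_def algebra_simps)

lemma minkowski_scaleR_right: "minkowski u (c *\<^sub>R v) = c * minkowski u v"
  by (simp add: minkowski_def algebra_simps)

lemmas minkowski_simps = minkowski_add_left minkowski_add_right minkowski_diff_left
  minkowski_diff_right minkowski_scaleR_left minkowski_scaleR_right

typedef (overloaded) ('a::euclidean_space) hyperbolic_space =
  "{u :: 'a \<times> real. minkowski u u = -1 \<and> snd u > 0}"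
  morphisms hyp_vec Abs_hyp
proof
  show "(0, 1) \<in> {u :: 'a \<times> real. minkowski u u = -1 \<and> snd u > 0}"
    by (simp add: minkowski_def)
qed

lemma minkowski_hyp_vec_self: "minkowski (hyp_vec p) (hyp_vec p) = -1"
  and snd_hyp_vec_pos: "snd (hyp_vec p) > 0"
  using hyp_vec[of p] by auto

lemma hyp_vec_snd_square: "(snd (hyp_vec p))\<^sup>2 = 1 + (norm (fst (hyp_vec p)))\<^sup>2"
proof -
  have "(snd (hyp_vec p))\<^sup>2 = 1 + fst (hyp_vec p) \<bullet> fst (hyp_vec p)"
    using minkowski_hyp_vec_self[of p] by (simp add: minkowski_def power2_eq_square)
  then show ?thesis by (simp add: power2_norm_eq_inner)
qed

lemma minkowski_hyp_vec_le: "minkowski (hyp_vec p) (hyp_vec q) \<le> -1" (is ?le)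
  and minkowski_hyp_vec_eq_iff: "minkowski (hyp_vec p) (hyp_vec q) = -1 \<longleftrightarrow> p = q" (is ?eq)
proof -
  obtain x s where p: "hyp_vec p = (x, s)" by fastforce
  obtain y t where q: "hyp_vec q = (y, t)" by fastforce
  have s: "s > 0" "s\<^sup>2 = 1 + (norm x)\<^sup>2"
    using snd_hyp_vec_pos[of p] hyp_vec_snd_square[of p] p by auto
  have t: "t > 0" "t\<^sup>2 = 1 + (norm y)\<^sup>2"
    using snd_hyp_vec_pos[of q] hyp_vec_snd_square[of q] q by auto
  have m: "minkowski (hyp_vec p) (hyp_vec q) = x \<bullet> y - s * t"
    by (simp add: p q minkowski_def)
  have st: "(s * t)\<^sup>2 = (1 + norm x * norm y)\<^sup>2 + (norm x - norm y)\<^sup>2"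
    unfolding power_mult_distrib s t by (simp add: power2_eq_square algebra_simps)
  have ge: "s * t \<ge> 1 + norm x * norm y"
    by (rule power2_le_imp_le) (use st s t in auto)
  have cs: "x \<bullet> y \<le> norm x * norm y" by (rule norm_cauchy_schwarz)
  show ?le using m ge cs by simp
  have "p = q" if "minkowski (hyp_vec p) (hyp_vec q) = -1"
  proof -
    have e: "s * t = 1 + norm x * norm y" "x \<bullet> y = norm x * norm y"
      using that m ge cs by auto
    have n: "norm x = norm y" using st e by simp
    have "(norm (x - y))\<^sup>2 = (norm x - norm y)\<^sup>2"
      using e(2) by (simp add: power2_norm_eq_inner[of "x - y"] inner_diff_left inner_diff_right
        inner_commute[of y x] power2_diff) (simp add: power2_norm_eq_inner)
    then have "x = y" using n by simp
    moreover have "s = t" using s t n by (metis less_imp_le power2_eq_imp_eq)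
    ultimately show "p = q" using p q by (metis hyp_vec_inject)
  qed
  then show ?eq using minkowski_hyp_vec_self by auto
qed

lemma minkowski_orthogonal_nonneg:
  assumes "minkowski x (hyp_vec p) = 0"
  shows "minkowski x x \<ge> 0"
proof -
  obtain y t where p: "hyp_vec p = (y, t)" by fastforce
  obtain z s where x: "x = (z, s)" by fastforce
  have t: "t > 0" "t\<^sup>2 = 1 + (norm y)\<^sup>2"
    using snd_hyp_vec_pos[of p] hyp_vec_snd_square[of p] p by auto
  have "s * t = z \<bullet> y" using assms by (simp add: p x minkowski_def)
  then have "\<bar>s\<bar> * t = \<bar>z \<bullet> y\<bar>" using t(1) by (metis abs_mult abs_of_pos)
  also have "\<dots> \<le> norm z * norm y" by (rule Cauchy_Schwarz_ineq2)
  also have "\<dots> \<le> norm z * t"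
    by (intro mult_left_mono power2_le_imp_le[of "norm y" t]) (use t in auto)
  finally have "\<bar>s\<bar> \<le> norm z" using t(1) by simp
  then have "s\<^sup>2 \<le> (norm z)\<^sup>2" by (metis abs_ge_zero power2_abs power_mono)
  then show ?thesis by (simp add: x minkowski_def power2_norm_eq_inner flip: power2_eq_square)
qed

lemma minkowski_hyp_vec_triangle:
  fixes p q r :: "'a::euclidean_space hyperbolic_space"
  defines "a \<equiv> - minkowski (hyp_vec p) (hyp_vec r)" and "b \<equiv> - minkowski (hyp_vec q) (hyp_vec r)"
  shows "- minkowski (hyp_vec p) (hyp_vec q) \<le> a * b + sqrt (a\<^sup>2 - 1) * sqrt (b\<^sup>2 - 1)"
proof (cases "p = r")
  case True
  then show ?thesis
    by (simp add: a_def b_def minkowski_hyp_vec_self minkowski_commute[of "hyp_vec r"])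
next
  case False
  define u where "u = hyp_vec p - a *\<^sub>R hyp_vec r"
  define v where "v = hyp_vec q - b *\<^sub>R hyp_vec r"
  have ur: "minkowski u (hyp_vec r) = 0" and vr: "minkowski v (hyp_vec r) = 0"
    by (simp_all add: u_def v_def a_def b_def minkowski_simps minkowski_hyp_vec_self)
  have uu: "minkowski u u = a\<^sup>2 - 1"
    by (simp add: u_def a_def minkowski_simps minkowski_hyp_vec_self
        minkowski_commute[of "hyp_vec r"] power2_eq_square)
  have vv: "minkowski v v = b\<^sup>2 - 1"
    by (simp add: v_def b_def minkowski_simps minkowski_hyp_vec_self
        minkowski_commute[of "hyp_vec r"] power2_eq_square)
  have uv: "minkowski u v = minkowski (hyp_vec p) (hyp_vec q) + a * b"
    by (simp add: u_def v_def a_def b_def minkowski_simps minkowski_hyp_vec_self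
        minkowski_commute[of "hyp_vec r"])
  have a: "a > 1"
    using False minkowski_hyp_vec_le[of p r] minkowski_hyp_vec_eq_iff[of p r]
    unfolding a_def by linarith
  then have pos: "a\<^sup>2 - 1 > 0" by (simp add: power2_eq_square less_1_mult)
  define w where "w = minkowski u u *\<^sub>R v - minkowski u v *\<^sub>R u"
  have "minkowski w (hyp_vec r) = 0" by (simp add: w_def minkowski_simps ur vr)
  then have "minkowski w w \<ge> 0" by (rule minkowski_orthogonal_nonneg)
  moreover have "minkowski w w =
      minkowski u u * (minkowski u u * minkowski v v - (minkowski u v)\<^sup>2)"
    by (simp add: w_def minkowski_simps minkowski_commute[of v u] power2_eq_square algebra_simps)
  ultimately have "(minkowski u v)\<^sup>2 \<le> minkowski u u * minkowski v v"
    using pos uu by (simp add: zero_le_mult_iff)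
  then have "\<bar>minkowski u v\<bar> \<le> sqrt (minkowski u u * minkowski v v)"
    by (metis real_sqrt_abs real_sqrt_le_mono)
  then show ?thesis by (simp add: uv uu vv real_sqrt_mult)
qed

instantiation hyperbolic_space :: (euclidean_space) metric_space
begin

definition dist_hyperbolic_space :: "'a hyperbolic_space \<Rightarrow> 'a hyperbolic_space \<Rightarrow> real" where
  "dist_hyperbolic_space p q = arcosh (- minkowski (hyp_vec p) (hyp_vec q))"

definition uniformity_hyperbolic_space :: "('a hyperbolic_space \<times> 'a hyperbolic_space) filter" where
  "uniformity_hyperbolic_space = (INF e\<in>{0<..}. principal {(x, y). dist x y < e})"

definition open_hyperbolic_space :: "'a hyperbolic_space set \<Rightarrow> bool" where
  "open_hyperbolic_space U \<longleftrightarrow> (\<forall>x\<in>U. eventually (\<lambda>(x', y). x' = x \<longrightarrow> y \<in> U) uniformity)"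

instance
proof
  fix p q r :: "'a hyperbolic_space"
  have ge: "- minkowski (hyp_vec p) (hyp_vec q) \<ge> 1" for p q :: "'a hyperbolic_space"
    using minkowski_hyp_vec_le[of p q] by simp
  show "dist p q = 0 \<longleftrightarrow> p = q"
    using minkowski_hyp_vec_eq_iff[of p q] ge[of p q]
    by (auto simp: dist_hyperbolic_space_def)
  have nn: "dist p q \<ge> 0" for p q :: "'a hyperbolic_space"
    using ge by (simp add: dist_hyperbolic_space_def)
  have ch: "cosh (dist p q) = - minkowski (hyp_vec p) (hyp_vec q)" for p q :: "'a hyperbolic_space"
    using ge by (simp add: dist_hyperbolic_space_def)
  have sh: "sinh (dist p q) = sqrt ((minkowski (hyp_vec p) (hyp_vec q))\<^sup>2 - 1)"
    for p q :: "'a hyperbolic_space"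
    using nn[of p q] ch[of p q] sinh_square_eq[of "dist p q"]
    by (metis power2_minus real_sqrt_unique sinh_real_nonneg_iff)
  have "cosh (dist p q) \<le> cosh (dist p r + dist q r)"
    using minkowski_hyp_vec_triangle[of p q r] by (simp add: cosh_add ch sh)
  then show "dist p q \<le> dist p r + dist q r"
    using nn by (simp add: cosh_real_nonneg_le_iff)
qed (simp_all add: uniformity_hyperbolic_space_def open_hyperbolic_space_def)

end

definition distance_preserving_on :: "'a set \<Rightarrow> ('a::metric_space \<Rightarrow> 'b::metric_space) \<Rightarrow> bool" where
  "distance_preserving_on S f \<longleftrightarrow> (\<forall>x\<in>S. \<forall>y\<in>S. dist (f x) (f y) = dist x y)"

definition is_isometry :: "('a::metric_space \<Rightarrow> 'b::metric_space) \<Rightarrow> bool" where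
  "is_isometry g \<longleftrightarrow> distance_preserving_on UNIV g \<and> surj g"

definition geodesically_convex :: "'a::metric_space set \<Rightarrow> bool" where
  "geodesically_convex K \<longleftrightarrow>
     (\<forall>(a::real) b \<gamma>. a \<le> b \<longrightarrow> distance_preserving_on {a..b} \<gamma> \<longrightarrow> \<gamma> a \<in> K \<longrightarrow> \<gamma> b \<in> K \<longrightarrow>
        \<gamma> ` {a..b} \<subseteq> K)"

definition geodesic_line :: "'a::metric_space set \<Rightarrow> bool" where
  "geodesic_line L \<longleftrightarrow> (\<exists>\<gamma> :: real \<Rightarrow> 'a. distance_preserving_on UNIV \<gamma> \<and> L = range \<gamma>)"

text \<open>
  From here on the ambient space is \<open>('a \<times> real) hyperbolic_space\<close>, that is, hyperbolic
  \<open>n\<close>-space with \<open>n = DIM('a) + 1 \<ge> 2\<close>, so that hyperbolic \<open>(n-1)\<close>-space is available as the type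
  \<open>'a hyperbolic_space\<close>. The complete totally geodesic copies of the latter are exactly its images
  under distance-preserving maps.
\<close>

definition hyperplane :: "('a::euclidean_space \<times> real) hyperbolic_space set \<Rightarrow> bool" where
  "hyperplane P \<longleftrightarrow>
     (\<exists>\<phi> :: 'a hyperbolic_space \<Rightarrow> ('a \<times> real) hyperbolic_space.
        distance_preserving_on UNIV \<phi> \<and> P = range \<phi>)"

definition line_param :: "real \<Rightarrow> real hyperbolic_space" where
  "line_param s = Abs_hyp (sinh s, cosh s)"

lemma hyp_vec_line_param: "hyp_vec (line_param s) = (sinh s, cosh s)"
proof -
  have "sinh s * sinh s - cosh s * cosh s = -1"
    using sinh_square_eq[of s] by (simp add: power2_eq_square)
  then show ?thesis
    by (simp add: line_param_def Abs_hyp_inverse minkowski_def)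
qed

lemma dist_line_param: "dist (line_param s) (line_param t) = dist s t"
proof -
  have "- minkowski (hyp_vec (line_param s)) (hyp_vec (line_param t)) = cosh \<bar>s - t\<bar>"
    by (simp add: hyp_vec_line_param minkowski_def cosh_diff)
  then show ?thesis
    by (simp add: dist_hyperbolic_space_def arcosh_cosh_real dist_real_def del: cosh_real_abs)
qed

lemma surj_line_param: "surj line_param"
proof -
  have "p = line_param (arsinh (fst (hyp_vec p)))" for p
  proof -
    obtain x t where p: "hyp_vec p = (x, t)" by fastforce
    have t: "t > 0" "t\<^sup>2 = 1 + x\<^sup>2"
      using snd_hyp_vec_pos[of p] hyp_vec_snd_square[of p] p by auto
    have "(cosh (arsinh x))\<^sup>2 = t\<^sup>2"
      using sinh_square_eq[of "arsinh x"] t by simp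
    then have "cosh (arsinh x) = t"
      using t(1) by (simp add: power2_eq_iff_nonneg)
    then have "hyp_vec p = hyp_vec (line_param (arsinh (fst (hyp_vec p))))"
      by (simp add: p hyp_vec_line_param)
    then show ?thesis by (simp only: hyp_vec_inject)
  qed
  then show ?thesis unfolding surj_def by blast
qed

lemma hyperplane_plane_iff_geodesic_line:
  fixes L :: "(real \<times> real) hyperbolic_space set"
  shows "hyperplane L \<longleftrightarrow> geodesic_line L"
proof
  assume "hyperplane L"
  then obtain \<phi> :: "real hyperbolic_space \<Rightarrow> _"
    where \<phi>: "distance_preserving_on UNIV \<phi>" "L = range \<phi>"
    by (auto simp: hyperplane_def)
  have "distance_preserving_on UNIV (\<phi> \<circ> line_param)"
    using \<phi>(1) by (simp add: distance_preserving_on_def dist_line_param)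
  moreover have "L = range (\<phi> \<circ> line_param)"
    using \<phi>(2) surj_line_param by (metis image_comp)
  ultimately show "geodesic_line L" unfolding geodesic_line_def by blast
next
  assume "geodesic_line L"
  then obtain \<gamma> :: "real \<Rightarrow> _" where \<gamma>: "distance_preserving_on UNIV \<gamma>" "L = range \<gamma>"
    by (auto simp: geodesic_line_def)
  have inj: "inj line_param"
    by (rule injI) (metis dist_eq_0_iff dist_line_param)
  have "distance_preserving_on UNIV (\<gamma> \<circ> inv line_param)"
    using \<gamma>(1) unfolding distance_preserving_on_def
    by (metis comp_apply UNIV_I dist_line_param surj_f_inv_f surj_line_param)
  moreover have "L = range (\<gamma> \<circ> inv line_param)"
    using \<gamma>(2) inj_imp_surj_inv[OF inj] by (metis image_comp)
  ultimately show "hyperplane L" unfolding hyperplane_def by blast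
qed

definition convex_class :: "('a::euclidean_space \<times> real) hyperbolic_space set set" where
  "convex_class =
     {K. closed K \<and> geodesically_convex K \<and> interior K \<noteq> {} \<and>
         (\<exists>\<H>. (\<forall>P\<in>\<H>. hyperplane P) \<and> disjoint \<H> \<and> frontier K = \<Union>\<H> \<and>
              (\<exists>T\<subseteq>\<H>. card T = 3))}"

definition quasi_isometry ::
  "'a::metric_space set \<Rightarrow> 'b::metric_space set \<Rightarrow> ('a \<Rightarrow> 'b) \<Rightarrow> bool" where
  "quasi_isometry X Y f \<longleftrightarrow>
     f \<in> X \<rightarrow> Y \<and>
     (\<exists>l\<ge>1. \<exists>k\<ge>0.
        (\<forall>x\<in>X. \<forall>x'\<in>X. 1 / l * dist x x' - k \<le> dist (f x) (f x') \<and>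
                          dist (f x) (f x') \<le> l * dist x x' + k) \<and>
        (\<forall>y\<in>Y. \<exists>x\<in>X. dist (f x) y \<le> k))"

definition finite_distance_on ::
  "'a set \<Rightarrow> ('a \<Rightarrow> 'b::metric_space) \<Rightarrow> ('a \<Rightarrow> 'b) \<Rightarrow> bool" where
  "finite_distance_on X f g \<longleftrightarrow> bdd_above ((\<lambda>x. dist (f x) (g x)) ` X)"

definition rigid :: "('a::euclidean_space \<times> real) hyperbolic_space set \<Rightarrow> bool" where
  "rigid K \<longleftrightarrow>
     (\<forall>K'\<in>convex_class. \<forall>f. quasi_isometry K K' f \<longrightarrow>
        (\<exists>g :: ('a \<times> real) hyperbolic_space \<Rightarrow> ('a \<times> real) hyperbolic_space.
           is_isometry g \<and> finite_distance_on K f g))"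

end

theory Submission
  imports Defs
begin

text \<open>
  Fix a boundary line \<open>L\<close> of \<open>K\<close> and Fermi coordinates \<open>(t, r)\<close> along it, so that \<open>L\<close> is
  \<open>r = 0\<close> and \<open>K\<close> lies in \<open>r \<ge> 0\<close>. Every other boundary line is a wall
  \<open>tanh r = p e\<^sup>t + q e\<^sup>-\<^sup>t\<close> with \<open>p, q \<ge> 0\<close>, and disjointness of the lines means that at each \<open>t\<close> at
  most one wall has value below 1. The stretch \<open>(t, r) \<mapsto> (2t, r)\<close> multiplies distances by a factor
  between 1 and 2. The image of \<open>K\<close> is not convex, but replacing the image of each wall \<open>w\<close> by the
  geodesic \<open>w'\<close> with the same ideal endpoints gives another member of the class, and from
  \<open>w' \<le> w\<close> and \<open>1 - w' \<le> 4 (1 - w)\<close> the image of \<open>K\<close> contains that member and stays at bounded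
  vertical distance from it. So the stretch followed by a bounded correction is a quasi-isometry,
  and it doubles distances on \<open>L\<close>, which no map near an isometry can do.
\<close>

section \<open>Geodesics and convexity in the hyperboloid model\<close>

lemma hyp_vec_Abs_hyp:
  assumes "minkowski u u = -1" "snd u > 0"
  shows "hyp_vec (Abs_hyp u) = u"
  using assms by (simp add: Abs_hyp_inverse)

lemma cosh_dist_hyp: "cosh (dist p q) = - minkowski (hyp_vec p) (hyp_vec q)"
  using minkowski_hyp_vec_le[of p q] by (simp add: dist_hyperbolic_space_def)

lemma dist_hyp_eqI:
  assumes "- minkowski (hyp_vec p) (hyp_vec q) = cosh d"
  shows "dist p q = \<bar>d\<bar>"
proof -
  have "dist p q = arcosh (cosh \<bar>d\<bar>)"
    unfolding dist_hyperbolic_space_def assms by simp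
  then show ?thesis by (simp add: arcosh_cosh_real del: cosh_real_abs)
qed

lemma minkowski_minus_left: "minkowski (- u) v = - minkowski u v"
  by (simp add: minkowski_def)

text \<open>Otherwise \<open>- v\<close> would be a point of the sheet, and its product with
  \<open>hyp_vec p\<close> would be at most -1, against the assumed sign.\<close>

lemma timelike_snd_pos:
  assumes "minkowski v v = -1" "minkowski v (hyp_vec p) < 0"
  shows "snd v > 0"
proof (rule ccontr)
  assume neg: "\<not> snd v > 0"
  have "snd v \<noteq> 0"
    using assms(1) inner_ge_zero[of "fst v"] unfolding minkowski_def by fastforce
  then have "hyp_vec (Abs_hyp (- v)) = - v"
    using neg assms(1) by (intro hyp_vec_Abs_hyp) (auto simp: minkowski_def)
  then have "minkowski (- v) (hyp_vec p) \<le> -1"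
    by (metis minkowski_hyp_vec_le)
  then show False using assms(2) by (simp add: minkowski_minus_left)
qed

text \<open>The orthogonal complement of a timelike vector is positive definite: the space part of a
  point is strictly shorter than its time coordinate, so Cauchy-Schwarz leaves only the zero
  vector.\<close>

lemma null_orthogonal_eq_0:
  assumes "minkowski x (hyp_vec p) = 0" "minkowski x x = 0"
  shows "x = 0"
proof -
  obtain y t where p: "hyp_vec p = (y, t)" by fastforce
  obtain z s where x: "x = (z, s)" by fastforce
  have t: "t > 0" "t\<^sup>2 = 1 + (norm y)\<^sup>2"
    using snd_hyp_vec_pos[of p] hyp_vec_snd_square[of p] p by auto
  have "norm y < t" by (rule power_less_imp_less_base[of _ 2]) (use t in auto)
  have "(norm z)\<^sup>2 = s\<^sup>2"
    using assms(2) by (simp add: x minkowski_def power2_norm_eq_inner) (simp add: power2_eq_square)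
  then have zs: "norm z = \<bar>s\<bar>" by (metis norm_ge_zero power2_abs abs_ge_zero power2_eq_imp_eq)
  have "s * t = z \<bullet> y" using assms(1) by (simp add: p x minkowski_def)
  then have "\<bar>s\<bar> * t = \<bar>z \<bullet> y\<bar>" using t(1) by (metis abs_mult abs_of_pos)
  also have "\<dots> \<le> \<bar>s\<bar> * norm y" unfolding zs[symmetric] by (rule Cauchy_Schwarz_ineq2)
  finally have "\<bar>s\<bar> = 0" using \<open>norm y < t\<close>
    by (metis abs_ge_zero leD mult_less_cancel_left_pos order_le_less)
  then show ?thesis using zs by (simp add: x zero_prod_def)
qed

text \<open>The difference of the two sides is orthogonal to \<open>p\<close>, \<open>q\<close> and
  \<open>x\<close>, hence to itself, hence zero. This turns metric betweenness, on which the
  definition of convexity rests, into linear algebra.\<close>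

lemma hyp_vec_between:
  fixes p q x :: "'a::euclidean_space hyperbolic_space"
  assumes "dist p q = dist p x + dist x q"
  shows "sinh (dist p q) *\<^sub>R hyp_vec x = sinh (dist x q) *\<^sub>R hyp_vec p + sinh (dist p x) *\<^sub>R hyp_vec q"
proof -
  define a b where "a = dist p x" and "b = dist x q"
  have m: "minkowski (hyp_vec p) (hyp_vec x) = - cosh a" "minkowski (hyp_vec x) (hyp_vec p) = - cosh a"
     "minkowski (hyp_vec x) (hyp_vec q) = - cosh b" "minkowski (hyp_vec q) (hyp_vec x) = - cosh b"
     "minkowski (hyp_vec p) (hyp_vec q) = - cosh (a + b)" "minkowski (hyp_vec q) (hyp_vec p) = - cosh (a + b)"
    using cosh_dist_hyp[of p x] cosh_dist_hyp[of x q] cosh_dist_hyp[of p q] assms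
    by (simp_all add: a_def b_def minkowski_commute)
  have cs: "(cosh a)\<^sup>2 = (sinh a)\<^sup>2 + 1" "(cosh b)\<^sup>2 = (sinh b)\<^sup>2 + 1"
    by (simp_all add: cosh_square_eq)
  define y where "y = sinh (a + b) *\<^sub>R hyp_vec x - sinh b *\<^sub>R hyp_vec p - sinh a *\<^sub>R hyp_vec q"
  have yx: "minkowski y (hyp_vec x) = 0"
    by (simp add: y_def minkowski_simps m minkowski_hyp_vec_self sinh_add algebra_simps)
  have yp: "minkowski y (hyp_vec p) = 0"
    by (simp add: y_def minkowski_simps m minkowski_hyp_vec_self sinh_add cosh_add)
      (use cs in algebra)
  have yq: "minkowski y (hyp_vec q) = 0"
    by (simp add: y_def minkowski_simps m minkowski_hyp_vec_self sinh_add cosh_add)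
      (use cs in algebra)
  have "minkowski y y = 0"
    by (subst (2) y_def) (simp add: minkowski_simps yx yp yq)
  then have "y = 0" using yx null_orthogonal_eq_0 by blast
  then show ?thesis unfolding y_def a_def b_def assms by (simp add: algebra_simps)
qed

text \<open>For a unit tangent vector \<open>e\<close> at \<open>p\<close> this is the unit-speed
  geodesic with initial velocity \<open>e\<close>. The parameter may be negative, so the range is a
  full line.\<close>

definition hyp_ray where
  "hyp_ray p e s = Abs_hyp (cosh s *\<^sub>R hyp_vec p + sinh s *\<^sub>R e)"

context
  fixes p :: "'a::euclidean_space hyperbolic_space" and e
  assumes unit: "minkowski e e = 1" and tangent: "minkowski e (hyp_vec p) = 0"
begin

lemma hyp_vec_ray: "hyp_vec (hyp_ray p e s) = cosh s *\<^sub>R hyp_vec p + sinh s *\<^sub>R e"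
proof -
  have t: "minkowski (hyp_vec p) e = 0" using tangent by (simp add: minkowski_commute)
  have "minkowski (cosh s *\<^sub>R hyp_vec p + sinh s *\<^sub>R e) (cosh s *\<^sub>R hyp_vec p + sinh s *\<^sub>R e) = -1"
    using cosh_square_eq[of s]
    by (simp add: minkowski_simps unit tangent t minkowski_hyp_vec_self power2_eq_square)
  then show ?thesis unfolding hyp_ray_def
    by (intro hyp_vec_Abs_hyp timelike_snd_pos[where p = p])
      (simp_all add: minkowski_simps minkowski_hyp_vec_self tangent)
qed

lemma distance_preserving_hyp_ray: "distance_preserving_on A (hyp_ray p e)"
proof -
  have t: "minkowski (hyp_vec p) e = 0" using tangent by (simp add: minkowski_commute)
  have "dist (hyp_ray p e x) (hyp_ray p e y) = \<bar>x - y\<bar>" for x y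
    by (rule dist_hyp_eqI)
      (simp add: hyp_vec_ray minkowski_simps unit tangent t minkowski_hyp_vec_self cosh_diff)
  then show ?thesis by (simp add: distance_preserving_on_def dist_real_def)
qed

end

text \<open>The vector \<open>e\<close> is the normalised component of \<open>hyp_vec q\<close>
  orthogonal to \<open>hyp_vec p\<close>, that is, the initial velocity of the geodesic from
  \<open>p\<close> to \<open>q\<close>.\<close>

lemma direction_to:
  fixes p q :: "'a::euclidean_space hyperbolic_space"
  assumes "p \<noteq> q"
  obtains e where "minkowski e e = 1" "minkowski e (hyp_vec p) = 0"
    "hyp_vec q = cosh (dist p q) *\<^sub>R hyp_vec p + sinh (dist p q) *\<^sub>R e"
proof
  let ?d = "dist p q"
  have s: "sinh ?d > 0" using assms by simp
  have m: "minkowski (hyp_vec p) (hyp_vec q) = - cosh ?d" "minkowski (hyp_vec q) (hyp_vec p) = - cosh ?d"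
    by (simp_all add: cosh_dist_hyp minkowski_commute)
  define e where "e = (1 / sinh ?d) *\<^sub>R (hyp_vec q - cosh ?d *\<^sub>R hyp_vec p)"
  show "hyp_vec q = cosh ?d *\<^sub>R hyp_vec p + sinh ?d *\<^sub>R e"
    using s by (simp add: e_def)
  show "minkowski e (hyp_vec p) = 0"
    by (simp add: e_def minkowski_simps m minkowski_hyp_vec_self)
  have "cosh ?d * cosh ?d - 1 = sinh ?d * sinh ?d"
    using cosh_square_eq[of ?d] by (simp add: power2_eq_square)
  then show "minkowski e e = 1" using s
    by (simp add: e_def minkowski_simps m minkowski_hyp_vec_self)
qed

text \<open>Converse direction to \<open>hyp_vec_between\<close>: such an \<open>x\<close> has the
  form \<open>hyp_ray p e s\<close>, where \<open>b \<ge> 0\<close> gives \<open>0 \<le> s\<close>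
  and \<open>a \<ge> 0\<close> gives \<open>s \<le> d\<close>, so \<open>x\<close> lies on the
  segment from \<open>p\<close> to \<open>q\<close>.\<close>

lemma geodesically_convex_combination:
  fixes p q x :: "'a::euclidean_space hyperbolic_space"
  assumes K: "geodesically_convex K" "p \<in> K" "q \<in> K"
    and x: "hyp_vec x = a *\<^sub>R hyp_vec p + b *\<^sub>R hyp_vec q" "a \<ge> 0" "b \<ge> 0"
  shows "x \<in> K"
proof (cases "p = q")
  case True
  then have *: "hyp_vec x = (a + b) *\<^sub>R hyp_vec p" using x by (simp add: algebra_simps)
  have "(a + b)\<^sup>2 = 1"
    using minkowski_hyp_vec_self[of x] unfolding *
    by (simp add: minkowski_simps minkowski_hyp_vec_self power2_eq_square algebra_simps)
  then have "a + b = 1" using x by (simp add: power2_eq_1_iff)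
  then show ?thesis using * K by (simp add: hyp_vec_inject)
next
  case False
  define d where "d = dist p q"
  have d: "sinh d > 0" "d > 0" using False by (auto simp: d_def)
  obtain e where e: "minkowski e e = 1" "minkowski e (hyp_vec p) = 0"
    and q: "hyp_vec q = cosh d *\<^sub>R hyp_vec p + sinh d *\<^sub>R e"
    using direction_to[OF False] unfolding d_def by blast
  have e': "minkowski (hyp_vec p) e = 0" using e(2) by (simp add: minkowski_commute)
  define s where "s = arsinh (b * sinh d)"
  have sb: "sinh s = b * sinh d" by (simp add: s_def)
  have x': "hyp_vec x = (a + b * cosh d) *\<^sub>R hyp_vec p + sinh s *\<^sub>R e"
    by (simp add: x q sb algebra_simps)
  have "(a + b * cosh d)\<^sup>2 = 1 + (sinh s)\<^sup>2"
    using minkowski_hyp_vec_self[of x] unfolding x'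
    by (simp add: minkowski_simps e e' minkowski_hyp_vec_self power2_eq_square algebra_simps)
  then have "(a + b * cosh d)\<^sup>2 = (cosh s)\<^sup>2" by (simp add: cosh_square_eq)
  then have c: "a + b * cosh d = cosh s"
    by (rule power2_eq_imp_eq) (use x in auto)
  have "sinh s \<ge> 0" unfolding sb using x d by simp
  then have s0: "s \<ge> 0" unfolding sinh_real_nonneg_iff .
  have "sinh (d - s) = a * sinh d"
    using sb c by (simp add: sinh_diff) algebra
  then have "sinh (d - s) \<ge> 0" using x d by simp
  then have "d - s \<ge> 0" unfolding sinh_real_nonneg_iff .
  have "hyp_ray p e s = x"
    using hyp_vec_ray[OF e, of s] x' c by (metis hyp_vec_inject)
  moreover have "hyp_ray p e 0 = p" using hyp_vec_ray[OF e, of 0] by (simp add: hyp_vec_inject)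
  moreover have "hyp_ray p e d = q" using hyp_vec_ray[OF e, of d] q by (metis hyp_vec_inject)
  ultimately show ?thesis
    using K d \<open>d - s \<ge> 0\<close> s0 distance_preserving_hyp_ray[OF e, of "{0..d}"]
    unfolding geodesically_convex_def
    by (metis (no_types, lifting) atLeastAtMost_iff diff_ge_0_iff_ge image_subset_iff less_imp_le)
qed

lemma geodesically_convex_halfspace: "geodesically_convex {x. 0 \<le> minkowski n (hyp_vec x)}"
  unfolding geodesically_convex_def
proof (intro allI impI subsetI)
  fix a b \<gamma> x
  assume ab: "(a::real) \<le> b" and \<gamma>: "distance_preserving_on {a..b} \<gamma>"
    and ends: "\<gamma> a \<in> {x. 0 \<le> minkowski n (hyp_vec x)}" "\<gamma> b \<in> {x. 0 \<le> minkowski n (hyp_vec x)}"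
    and "x \<in> \<gamma> ` {a..b}"
  then obtain s where s: "x = \<gamma> s" "a \<le> s" "s \<le> b" by auto
  have d: "dist (\<gamma> a) (\<gamma> s) = s - a" "dist (\<gamma> s) (\<gamma> b) = b - s" "dist (\<gamma> a) (\<gamma> b) = b - a"
    using \<gamma> s ab by (auto simp: distance_preserving_on_def dist_real_def)
  show "x \<in> {x. 0 \<le> minkowski n (hyp_vec x)}"
  proof (cases "a = b")
    case True
    then show ?thesis using s ends by auto
  next
    case False
    have "sinh (b - a) *\<^sub>R hyp_vec x = sinh (b - s) *\<^sub>R hyp_vec (\<gamma> a) + sinh (s - a) *\<^sub>R hyp_vec (\<gamma> b)"
      using hyp_vec_between[of "\<gamma> a" "\<gamma> b" "\<gamma> s"] d s by simp
    then have "sinh (b - a) * minkowski n (hyp_vec x) =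
        sinh (b - s) * minkowski n (hyp_vec (\<gamma> a)) + sinh (s - a) * minkowski n (hyp_vec (\<gamma> b))"
      by (metis minkowski_add_right minkowski_scaleR_right)
    also have "\<dots> \<ge> 0" using ends s by simp
    finally show ?thesis using False ab by (simp add: zero_le_mult_iff)
  qed
qed

lemma geodesically_convex_Inter:
  assumes "\<And>A. A \<in> F \<Longrightarrow> geodesically_convex A"
  shows "geodesically_convex (\<Inter>F)"
  using assms unfolding geodesically_convex_def by (simp add: le_Inf_iff)

text \<open>The topology is given by the metric, so continuity has to come from distances: the
  product with a fixed point of the sheet is minus the cosh of a distance. The points
  \<open>(0, 1)\<close> and \<open>(sinh 1 *\<^sub>R b, cosh 1)\<close> suffice to recover every
  coordinate.\<close>

lemma continuous_on_hyp_vec: "continuous_on UNIV (hyp_vec :: 'a::euclidean_space hyperbolic_space \<Rightarrow> _)"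
proof -
  have pt: "continuous_on UNIV (\<lambda>p. minkowski u (hyp_vec p))"
    if u: "minkowski u u = -1" "snd u > 0" for u :: "'a \<times> real"
  proof -
    have "minkowski u (hyp_vec p) = - cosh (dist (Abs_hyp u) p)" for p
      by (simp add: cosh_dist_hyp hyp_vec_Abs_hyp u)
    then show ?thesis by (simp add: continuous_intros)
  qed
  have "snd (hyp_vec p) = - minkowski (0, 1) (hyp_vec p)" for p :: "'a hyperbolic_space"
    by (simp add: minkowski_def)
  then have s: "continuous_on UNIV (\<lambda>p::'a hyperbolic_space. snd (hyp_vec p))"
    using continuous_on_minus[OF pt[of "(0, 1)"]] by (simp add: minkowski_def)
  have "continuous_on UNIV (\<lambda>p::'a hyperbolic_space. fst (hyp_vec p) \<bullet> b)" if b: "b \<in> Basis" for b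
  proof -
    have "fst (hyp_vec p) \<bullet> b =
        (minkowski (sinh 1 *\<^sub>R b, cosh 1) (hyp_vec p) + cosh 1 * snd (hyp_vec p)) / sinh 1"
      for p :: "'a hyperbolic_space"
      by (simp add: minkowski_def inner_commute)
    moreover have "continuous_on UNIV (\<lambda>p. minkowski (sinh 1 *\<^sub>R b, cosh 1) (hyp_vec p))"
      using b cosh_square_eq[of "1::real"] by (intro pt) (auto simp: minkowski_def power2_eq_square)
    ultimately show ?thesis
      using s by (auto intro!: continuous_intros)
  qed
  then have "continuous_on UNIV (\<lambda>p::'a hyperbolic_space. fst (hyp_vec p))"
    by (subst continuous_on_componentwise) blast
  then have "continuous_on UNIV (\<lambda>p::'a hyperbolic_space. (fst (hyp_vec p), snd (hyp_vec p)))"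
    using s by (intro continuous_on_Pair)
  then show ?thesis by simp
qed

lemma continuous_on_minkowski [continuous_intros]:
  assumes "continuous_on A f" "continuous_on A g"
  shows "continuous_on A (\<lambda>x. minkowski (f x) (g x))"
  unfolding minkowski_def using assms by (intro continuous_intros)


section \<open>Lines of the hyperbolic plane as zero sets\<close>

text \<open>The Lorentzian cross product: the Euclidean one with the sign of the timelike coordinate
  reversed. It completes an orthonormal pair to a frame.\<close>

definition minkowski_cross :: "(real \<times> real) \<times> real \<Rightarrow> (real \<times> real) \<times> real \<Rightarrow> (real \<times> real) \<times> real" where
  "minkowski_cross u v =
     ((snd (fst u) * snd v - snd u * snd (fst v), snd u * fst (fst v) - fst (fst u) * snd v),
      snd (fst u) * fst (fst v) - fst (fst u) * snd (fst v))"

lemma minkowski_cross_self: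
  "minkowski (minkowski_cross u v) (minkowski_cross u v) =
     (minkowski u v)\<^sup>2 - minkowski u u * minkowski v v"
  by (simp add: minkowski_cross_def minkowski_def inner_prod_def power2_eq_square algebra_simps)

lemma minkowski_cross_orthogonal:
  "minkowski (minkowski_cross u v) u = 0" "minkowski (minkowski_cross u v) v = 0"
  by (simp_all add: minkowski_cross_def minkowski_def inner_prod_def algebra_simps)

definition minkowski_frame where
  "minkowski_frame a b c \<longleftrightarrow> minkowski a a = 1 \<and> minkowski b b = 1 \<and> minkowski c c = -1 \<and>
     minkowski a b = 0 \<and> minkowski a c = 0 \<and> minkowski b c = 0"

text \<open>Products with the frame vectors recover the coefficients of a combination, so the
  combination map is injective, and therefore onto by equality of dimensions.\<close>

lemma minkowski_frame_expansion:
  fixes a b c x :: "(real \<times> real) \<times> real"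
  assumes "minkowski_frame a b c"
  shows "x = minkowski x a *\<^sub>R a + minkowski x b *\<^sub>R b - minkowski x c *\<^sub>R c"
proof -
  define \<Phi> where "\<Phi> v = fst (fst v) *\<^sub>R a + snd (fst v) *\<^sub>R b + snd v *\<^sub>R c" for v :: "(real \<times> real) \<times> real"
  have coords: "minkowski (\<Phi> v) a = fst (fst v)" "minkowski (\<Phi> v) b = snd (fst v)"
      "minkowski (\<Phi> v) c = - snd v" for v
    using assms minkowski_commute[of b a] minkowski_commute[of c a] minkowski_commute[of c b]
    by (simp_all add: \<Phi>_def minkowski_simps minkowski_frame_def)
  have "linear \<Phi>"
    by (rule linearI) (simp_all add: \<Phi>_def algebra_simps)
  moreover have "inj \<Phi>"
    by (rule injI) (metis coords neg_equal_iff_equal prod.expand)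
  ultimately obtain v where v: "x = \<Phi> v"
    by (metis linear_injective_imp_surjective surjD)
  show ?thesis by (simp add: v coords) (simp add: \<Phi>_def)
qed

text \<open>On the zero set of \<open>n\<close> the frame expansion has only an \<open>e\<close> and
  a \<open>p\<close> part, and the normalisation of points forces the coefficients to be
  \<open>sinh s\<close> and \<open>cosh s\<close>.\<close>

lemma range_hyp_ray:
  fixes p :: "(real \<times> real) hyperbolic_space"
  assumes "minkowski_frame e n (hyp_vec p)"
  shows "range (hyp_ray p e) = {x. minkowski n (hyp_vec x) = 0}"
proof -
  have e: "minkowski e e = 1" "minkowski e (hyp_vec p) = 0" "minkowski n e = 0" "minkowski n (hyp_vec p) = 0"
    using assms by (auto simp: minkowski_frame_def minkowski_commute)
  have "minkowski n (hyp_vec (hyp_ray p e s)) = 0" for s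
    by (simp add: hyp_vec_ray e minkowski_simps)
  moreover have "x \<in> range (hyp_ray p e)" if x: "minkowski n (hyp_vec x) = 0" for x
  proof -
    define s where "s = arsinh (minkowski (hyp_vec x) e)"
    define c where "c = - minkowski (hyp_vec x) (hyp_vec p)"
    have x': "hyp_vec x = sinh s *\<^sub>R e + c *\<^sub>R hyp_vec p"
      using minkowski_frame_expansion[OF assms, of "hyp_vec x"] x
      by (simp add: s_def c_def minkowski_commute)
    have "c\<^sup>2 = 1 + (sinh s)\<^sup>2"
      using minkowski_hyp_vec_self[of x] e minkowski_commute[of "hyp_vec p" e] unfolding x'
      by (simp add: minkowski_simps minkowski_hyp_vec_self power2_eq_square algebra_simps)
    then have "c\<^sup>2 = (cosh s)\<^sup>2" by (simp add: cosh_square_eq)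
    moreover have "c \<ge> 0" using minkowski_hyp_vec_le[of x p] by (simp add: c_def)
    ultimately have "c = cosh s" by (rule power2_eq_imp_eq) auto
    then have "hyp_vec x = hyp_vec (hyp_ray p e s)"
      using x' by (simp add: hyp_vec_ray e)
    then show ?thesis by (metis hyp_vec_inject rangeI)
  qed
  ultimately show ?thesis by auto
qed

lemma geodesic_line_zero_set:
  fixes n :: "(real \<times> real) \<times> real"
  assumes "minkowski n n > 0" "minkowski n (hyp_vec p) = 0"
  shows "geodesic_line {x. minkowski n (hyp_vec x) = 0}"
proof -
  define m where "m = (1 / sqrt (minkowski n n)) *\<^sub>R n"
  define e where "e = minkowski_cross m (hyp_vec p)"
  have m: "minkowski m m = 1" "minkowski m (hyp_vec p) = 0"
    using assms by (simp_all add: m_def minkowski_simps)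
  have f: "minkowski_frame e m (hyp_vec p)"
    using m by (simp add: minkowski_frame_def e_def minkowski_cross_self minkowski_cross_orthogonal
        minkowski_hyp_vec_self)
  have "{x. minkowski n (hyp_vec x) = 0} = {x. minkowski m (hyp_vec x) = 0}"
    using assms by (simp add: m_def minkowski_simps)
  moreover have "distance_preserving_on UNIV (hyp_ray p e)"
    using f by (intro distance_preserving_hyp_ray) (simp_all add: minkowski_frame_def)
  ultimately show ?thesis
    using range_hyp_ray[OF f] unfolding geodesic_line_def by metis
qed

text \<open>A geodesic line is given only metrically. Its direction is read off from two of its
  points, and the rest of the line is then forced.\<close>

lemma geodesic_line_frame:
  fixes L :: "(real \<times> real) hyperbolic_space set"
  assumes "geodesic_line L"
  obtains e n p where "minkowski_frame e n (hyp_vec p)" "L = {x. minkowski n (hyp_vec x) = 0}"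
    "L = range (hyp_ray p e)"
proof -
  obtain \<gamma> :: "real \<Rightarrow> _" where \<gamma>: "distance_preserving_on UNIV \<gamma>" "L = range \<gamma>"
    using assms by (auto simp: geodesic_line_def)
  have d: "dist (\<gamma> s) (\<gamma> t) = \<bar>s - t\<bar>" for s t
    using \<gamma> by (simp add: distance_preserving_on_def dist_real_def)
  have "\<gamma> 0 \<noteq> \<gamma> 1" using d[of 0 1] by auto
  then obtain e where e: "minkowski e e = 1" "minkowski e (hyp_vec (\<gamma> 0)) = 0"
    and \<gamma>1: "hyp_vec (\<gamma> 1) = cosh 1 *\<^sub>R hyp_vec (\<gamma> 0) + sinh 1 *\<^sub>R e"
    using direction_to[of "\<gamma> 0" "\<gamma> 1"] by (auto simp: d)
  define n where "n = minkowski_cross e (hyp_vec (\<gamma> 0))"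
  have f: "minkowski_frame e n (hyp_vec (\<gamma> 0))"
    using e minkowski_cross_orthogonal[of e "hyp_vec (\<gamma> 0)"]
    by (simp add: minkowski_frame_def n_def minkowski_cross_self minkowski_hyp_vec_self minkowski_commute)
  have n: "minkowski n (hyp_vec (\<gamma> 0)) = 0" "minkowski n (hyp_vec (\<gamma> 1)) = 0"
    by (simp_all add: n_def minkowski_cross_orthogonal minkowski_simps \<gamma>1)
  have ray: "hyp_ray (\<gamma> 0) e 0 = \<gamma> 0" "hyp_ray (\<gamma> 0) e 1 = \<gamma> 1"
    using hyp_vec_ray[OF e, of 0] hyp_vec_ray[OF e, of 1] \<gamma>1 by (simp_all flip: hyp_vec_inject)
  have lin: "sinh (t - r) * minkowski n (hyp_vec (\<gamma> s)) =
      sinh (t - s) * minkowski n (hyp_vec (\<gamma> r)) + sinh (s - r) * minkowski n (hyp_vec (\<gamma> t))"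
    if "r \<le> s" "s \<le> t" for r s t
    using hyp_vec_between[of "\<gamma> r" "\<gamma> t" "\<gamma> s"] that
    by (simp add: d) (metis minkowski_add_right minkowski_scaleR_right)
  \<comment> \<open>Wherever \<open>t\<close> lies relative to 0 and 1, the relation
    \<open>lin\<close> for these three parameters has two vanishing values and so forces the
    third.\<close>
  have on: "minkowski n (hyp_vec (\<gamma> t)) = 0" for t
  proof -
    consider "t < 0" | "0 \<le> t" "t \<le> 1" | "t > 1" by linarith
    then show ?thesis
      using lin[of t 0 1] lin[of 0 t 1] lin[of 0 1 t] n by cases auto
  qed
  \<comment> \<open>The distances to \<open>\<gamma> 0\<close> and \<open>\<gamma> 1\<close>
    determine the position on the line.\<close>
  have eq: "hyp_ray (\<gamma> 0) e t = \<gamma> t" for t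
  proof -
    obtain s where s: "\<gamma> t = hyp_ray (\<gamma> 0) e s" using on range_hyp_ray[OF f] by blast
    have "dist (hyp_ray (\<gamma> 0) e s) (hyp_ray (\<gamma> 0) e u) = \<bar>s - u\<bar>" for u
      using distance_preserving_hyp_ray[OF e, of UNIV] by (simp add: distance_preserving_on_def dist_real_def)
    from this[of 0] this[of 1] have "\<bar>t\<bar> = \<bar>s\<bar>" "\<bar>t - 1\<bar> = \<bar>s - 1\<bar>"
      using d[of t 0] d[of t 1] by (simp_all add: ray flip: s)
    then have "s = t" by linarith
    then show ?thesis using s by simp
  qed
  then have "L = range (hyp_ray (\<gamma> 0) e)" using \<gamma>(2) by (metis image_cong)
  then show ?thesis using that f range_hyp_ray[OF f] by blast
qed

section \<open>Isometries of the plane from Minkowski-orthonormal frames\<close>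

definition frame_map where
  "frame_map a b c x = Abs_hyp (fst (fst (hyp_vec x)) *\<^sub>R a + snd (fst (hyp_vec x)) *\<^sub>R b + snd (hyp_vec x) *\<^sub>R c)"

context
  fixes a b and p :: "(real \<times> real) hyperbolic_space"
  assumes frame: "minkowski_frame a b (hyp_vec p)"
begin

lemma minkowski_frame_combination:
  "minkowski (x *\<^sub>R a + y *\<^sub>R b + z *\<^sub>R hyp_vec p) (x' *\<^sub>R a + y' *\<^sub>R b + z' *\<^sub>R hyp_vec p) = x * x' + y * y' - z * z'"
  using frame minkowski_commute[of b a] minkowski_commute[of "hyp_vec p" a] minkowski_commute[of "hyp_vec p" b]
  by (simp add: minkowski_simps minkowski_frame_def)

lemma hyp_vec_frame_map:
  "hyp_vec (frame_map a b (hyp_vec p) x) =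
     fst (fst (hyp_vec x)) *\<^sub>R a + snd (fst (hyp_vec x)) *\<^sub>R b + snd (hyp_vec x) *\<^sub>R hyp_vec p"
  unfolding frame_map_def
proof (intro hyp_vec_Abs_hyp timelike_snd_pos[where p = p])
  let ?u = "fst (fst (hyp_vec x)) *\<^sub>R a + snd (fst (hyp_vec x)) *\<^sub>R b + snd (hyp_vec x) *\<^sub>R hyp_vec p"
  show "minkowski ?u ?u = -1"
    using minkowski_hyp_vec_self[of x] by (simp add: minkowski_frame_combination) (simp add: minkowski_def inner_prod_def)
  then show "minkowski ?u ?u = -1" .
  show "minkowski ?u (hyp_vec p) < 0"
    using frame snd_hyp_vec_pos[of x]
    by (simp add: minkowski_simps minkowski_frame_def)
qed

lemma is_isometry_frame_map: "is_isometry (frame_map a b (hyp_vec p))"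
proof -
  have "dist (frame_map a b (hyp_vec p) x) (frame_map a b (hyp_vec p) y) = dist x y" for x y
    unfolding dist_hyperbolic_space_def hyp_vec_frame_map minkowski_frame_combination
    by (simp add: minkowski_def inner_prod_def)
  moreover have "\<exists>y. x = frame_map a b (hyp_vec p) y" for x
  proof
    define u where "u = ((minkowski (hyp_vec x) a, minkowski (hyp_vec x) b), - minkowski (hyp_vec x) (hyp_vec p))"
    have x: "hyp_vec x = fst (fst u) *\<^sub>R a + snd (fst u) *\<^sub>R b + snd u *\<^sub>R hyp_vec p"
      using minkowski_frame_expansion[OF frame, of "hyp_vec x"] by (simp add: u_def)
    have "hyp_vec (Abs_hyp u) = u"
    proof (rule hyp_vec_Abs_hyp)
      show "minkowski u u = -1"
        using minkowski_hyp_vec_self[of x] unfolding x minkowski_frame_combination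
        by (simp add: minkowski_def inner_prod_def)
      show "snd u > 0" using minkowski_hyp_vec_le[of x p] by (simp add: u_def)
    qed
    then show "x = frame_map a b (hyp_vec p) (Abs_hyp u)"
      using x hyp_vec_frame_map[of "Abs_hyp u"] by (metis hyp_vec_inject)
  qed
  ultimately show ?thesis unfolding is_isometry_def distance_preserving_on_def surj_def by blast
qed

end

section \<open>Intersections of half-planes\<close>

text \<open>Moving \<open>z\<close> slightly to \<open>y\<close> and solving
  \<open>y = a p' + b q\<close> for \<open>p'\<close> gives a vector that, once normalised, is close
  to \<open>p\<close> and so in \<open>K\<close>. Then \<open>y\<close> is a combination of two
  points of \<open>K\<close>.\<close>

lemma interior_geodesic_combination:
  fixes p q z :: "'a::euclidean_space hyperbolic_space"
  assumes K: "geodesically_convex K" "p \<in> interior K" "q \<in> K"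
    and z: "hyp_vec z = a *\<^sub>R hyp_vec p + b *\<^sub>R hyp_vec q" "a > 0" "b \<ge> 0"
  shows "z \<in> interior K"
proof -
  obtain \<epsilon> where \<epsilon>: "\<epsilon> > 0" "ball p \<epsilon> \<subseteq> K" using K(2) by (auto simp: mem_interior)
  define v where "v y = (1 / a) *\<^sub>R (hyp_vec y - b *\<^sub>R hyp_vec q)" for y
  \<comment> \<open>These open conditions say that \<open>v y\<close> is timelike, points to the
    upper sheet, and after normalisation lies within \<epsilon> of \<open>p\<close>.\<close>
  define U where "U = {y. minkowski (v y) (v y) < 0 \<and> minkowski (v y) (hyp_vec p) < 0 \<and>
      - minkowski (v y) (hyp_vec p) < cosh \<epsilon> * sqrt (- minkowski (v y) (v y))}"
  have v: "continuous_on UNIV v" unfolding v_def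
    by (intro continuous_intros continuous_on_hyp_vec)
  have "open U" unfolding U_def
    by (intro open_Collect_conj open_Collect_less continuous_intros v)
  moreover have "z \<in> U"
    using \<epsilon> z cosh_real_nonneg_less_iff[of 0 \<epsilon>] by (simp add: U_def v_def minkowski_hyp_vec_self)
  moreover have "U \<subseteq> K"
  proof
    fix y assume y: "y \<in> U"
    define r where "r = sqrt (- minkowski (v y) (v y))"
    have r: "r > 0" "r\<^sup>2 = - minkowski (v y) (v y)" using y by (auto simp: U_def r_def)
    define w where "w = (1 / r) *\<^sub>R v y"
    have w: "minkowski w w = -1" "minkowski w (hyp_vec p) < 0"
      using r y by (simp_all add: w_def U_def minkowski_simps divide_simps power2_eq_square)
    then have w': "hyp_vec (Abs_hyp w) = w"
      by (intro hyp_vec_Abs_hyp timelike_snd_pos)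
    have "cosh (dist p (Abs_hyp w)) < cosh \<epsilon>"
      using y r by (simp add: cosh_dist_hyp minkowski_commute[of "hyp_vec p"] w')
        (simp add: w_def minkowski_simps U_def r_def divide_simps mult.commute)
    then have "Abs_hyp w \<in> K" using \<epsilon> by (auto simp: cosh_real_nonneg_less_iff)
    moreover have "hyp_vec y = (a * r) *\<^sub>R hyp_vec (Abs_hyp w) + b *\<^sub>R hyp_vec q"
      unfolding w' using r z by (simp add: w_def v_def)
    ultimately show "y \<in> K"
      using K(3) r z by (intro geodesically_convex_combination[OF K(1), of "Abs_hyp w" q y "a * r" b]) auto
  qed
  ultimately show ?thesis by (rule interiorI)
qed

text \<open>Each boundary line gets the normal that is positive at a fixed interior point
  \<open>p\<close>. A point of \<open>K\<close> on the wrong side of a line would make that line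
  meet the interior, while the segment from \<open>p\<close> to a point outside \<open>K\<close>
  crosses some boundary line.\<close>

lemma convex_class_halfplanes:
  fixes K :: "(real \<times> real) hyperbolic_space set"
  assumes K: "closed K" "geodesically_convex K" "interior K \<noteq> {}"
    and H: "frontier K = \<Union>H" "\<And>P. P \<in> H \<Longrightarrow> geodesic_line P"
  obtains N where "\<And>P. P \<in> H \<Longrightarrow> P = {x. minkowski (N P) (hyp_vec x) = 0}"
    "K = {x. \<forall>P\<in>H. 0 \<le> minkowski (N P) (hyp_vec x)}"
proof -
  obtain p where p: "p \<in> interior K" using K by blast
  have pK: "p \<in> K" using p interior_subset by blast
  have front: "frontier K \<inter> interior K = {}" "frontier K \<subseteq> K"
    using K(1) by (auto simp: frontier_def)
  have "\<exists>n. P = {x. minkowski n (hyp_vec x) = 0} \<and> 0 < minkowski n (hyp_vec p)" if P: "P \<in> H" for P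
  proof -
    obtain n where n: "P = {x. minkowski n (hyp_vec x) = 0}"
      using geodesic_line_frame[OF H(2)[OF P]] by metis
    moreover have "P = {x. minkowski (- n) (hyp_vec x) = 0}"
      using n by (simp add: minkowski_minus_left)
    moreover have "minkowski n (hyp_vec p) \<noteq> 0" using p front(1) P H(1) n by blast
    ultimately show ?thesis by (metis minkowski_minus_left neg_0_less_iff_less linorder_neqE_linordered_idom)
  qed
  then obtain N where N: "\<And>P. P \<in> H \<Longrightarrow> P = {x. minkowski (N P) (hyp_vec x) = 0}"
      "\<And>P. P \<in> H \<Longrightarrow> 0 < minkowski (N P) (hyp_vec p)"
    by metis
  have below: "0 \<le> minkowski (N P) (hyp_vec x)" if x: "x \<in> K" and P: "P \<in> H" for x P
  proof (rule ccontr)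
    assume neg: "\<not> 0 \<le> minkowski (N P) (hyp_vec x)"
    define a b where "a = minkowski (N P) (hyp_vec p)" and "b = - minkowski (N P) (hyp_vec x)"
    have ab: "a > 0" "b > 0" using neg N(2)[OF P] by (auto simp: a_def b_def)
    \<comment> \<open>The weights are chosen so that \<open>N P\<close> vanishes on
      \<open>w\<close>. Normalised, \<open>w\<close> is the point where the segment from
      \<open>p\<close> to \<open>x\<close> crosses \<open>P\<close>.\<close>
    define w where "w = b *\<^sub>R hyp_vec p + a *\<^sub>R hyp_vec x"
    define r where "r = sqrt (- minkowski w w)"
    have m: "minkowski (hyp_vec p) (hyp_vec x) \<le> -1" "minkowski (hyp_vec x) (hyp_vec p) \<le> -1"
      by (rule minkowski_hyp_vec_le)+
    have neg2: "a * b * minkowski (hyp_vec x) (hyp_vec p) < 0"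
      using ab m by (simp add: mult_pos_neg)
    have "minkowski w w = - (a * a) - b * b + 2 * (a * b * minkowski (hyp_vec x) (hyp_vec p))"
      by (simp add: w_def minkowski_simps minkowski_hyp_vec_self minkowski_commute[of "hyp_vec p"] algebra_simps)
    then have "minkowski w w < 0" using ab neg2 zero_le_square[of a] zero_le_square[of b] by linarith
    then have r: "r > 0" "r * r = - minkowski w w" by (auto simp: r_def)
    have wp: "minkowski w (hyp_vec p) < 0"
    proof -
      have "a * minkowski (hyp_vec x) (hyp_vec p) < 0" using ab m by (simp add: mult_pos_neg)
      then show ?thesis using ab by (simp add: w_def minkowski_simps minkowski_hyp_vec_self)
    qed
    define z where "z = Abs_hyp ((1 / r) *\<^sub>R w)"
    have z: "hyp_vec z = (1 / r) *\<^sub>R w" unfolding z_def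
      using r wp by (intro hyp_vec_Abs_hyp timelike_snd_pos[where p = p])
        (use \<open>minkowski w w < 0\<close> in \<open>simp_all add: minkowski_simps divide_simps\<close>)
    have "minkowski (N P) (hyp_vec z) = 0"
      by (simp add: z w_def minkowski_simps) (simp add: a_def b_def)
    then have "z \<in> frontier K" using N(1)[OF P] P H(1) by blast
    moreover have "z \<in> interior K"
      using interior_geodesic_combination[OF K(2) p x, of z "b / r" "a / r"] ab r
      by (simp add: z w_def algebra_simps)
    ultimately show False using front by blast
  qed
  have "\<exists>P\<in>H. minkowski (N P) (hyp_vec x) < 0" if x: "x \<notin> K" for x
  proof -
    define d where "d = dist p x"
    have "p \<noteq> x" using x pK by blast
    then have d: "d > 0" by (simp add: d_def)
    obtain e where e: "minkowski e e = 1" "minkowski e (hyp_vec p) = 0"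
        and x': "hyp_vec x = cosh d *\<^sub>R hyp_vec p + sinh d *\<^sub>R e"
      using direction_to[OF \<open>p \<noteq> x\<close>] unfolding d_def by blast
    have dp: "distance_preserving_on {0..d} (hyp_ray p e)"
      by (rule distance_preserving_hyp_ray[OF e])
    have "1-lipschitz_on {0..d} (hyp_ray p e)"
      using dp by (auto simp: lipschitz_on_def distance_preserving_on_def)
    then have "connected (hyp_ray p e ` {0..d})"
      by (intro connected_continuous_image lipschitz_on_continuous_on) auto
    moreover have "hyp_ray p e 0 = p" "hyp_ray p e d = x"
      using hyp_vec_ray[OF e, of 0] hyp_vec_ray[OF e, of d] x' by (simp_all flip: hyp_vec_inject)
    then have "p \<in> hyp_ray p e ` {0..d}" "x \<in> hyp_ray p e ` {0..d}" using d by force+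
    ultimately have "hyp_ray p e ` {0..d} \<inter> frontier K \<noteq> {}"
      using connected_Int_frontier[of _ K] x pK by blast
    then obtain s where s: "0 \<le> s" "s \<le> d" and fr: "hyp_ray p e s \<in> frontier K" by auto
    then obtain P where P: "P \<in> H" "hyp_ray p e s \<in> P" using H(1) by blast
    define A E where "A = minkowski (N P) (hyp_vec p)" and "E = minkowski (N P) e"
    have A: "A > 0" using N(2) P by (simp add: A_def)
    have "s \<noteq> d" using fr front \<open>hyp_ray p e d = x\<close> x by auto
    then have "sinh (d - s) > 0" using s by simp
    have "s \<noteq> 0" using fr front \<open>hyp_ray p e 0 = p\<close> p by auto
    then have s0: "sinh s > 0" using s by simp
    have "cosh s * A + sinh s * E = 0"
    proof -
      have "minkowski (N P) (hyp_vec (hyp_ray p e s)) = 0" using N(1)[OF P(1)] P(2) by blast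
      then show ?thesis by (simp add: hyp_vec_ray[OF e] minkowski_simps A_def E_def)
    qed
    \<comment> \<open>Eliminating \<open>E\<close> shows that the value along the ray, positive at 0
      and zero at \<open>s\<close>, is negative further out at \<open>d\<close>.\<close>
    then have "sinh s * (cosh d * A + sinh d * E) = - sinh (d - s) * A"
      by (simp add: sinh_diff) algebra
    also have "\<dots> < 0" using A \<open>sinh (d - s) > 0\<close> by (simp add: mult_neg_pos)
    finally have "cosh d * A + sinh d * E < 0" using s0 by (simp add: mult_less_0_iff)
    then show ?thesis using P(1) by (auto simp: x' minkowski_simps A_def E_def)
  qed
  then have "K = {x. \<forall>P\<in>H. 0 \<le> minkowski (N P) (hyp_vec x)}"
    using below by (auto simp: not_less) (meson not_less)
  then show ?thesis using that N(1) by blast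
qed

section \<open>Walls in Fermi coordinates\<close>

text \<open>Fermi coordinates along the line of points with vanishing second coordinate: \<open>t\<close> is the
  position on that line, \<open>r\<close> the signed distance to it.\<close>

definition fermi :: "real \<Rightarrow> real \<Rightarrow> (real \<times> real) hyperbolic_space" where
  "fermi t r = Abs_hyp ((sinh t * cosh r, sinh r), cosh t * cosh r)"

lemma hyp_vec_fermi: "hyp_vec (fermi t r) = ((sinh t * cosh r, sinh r), cosh t * cosh r)"
proof -
  have "(sinh t * cosh r)\<^sup>2 + (sinh r)\<^sup>2 - (cosh t * cosh r)\<^sup>2 = -1"
    by (simp add: power_mult_distrib cosh_square_eq algebra_simps)
  then show ?thesis unfolding fermi_def
    by (intro hyp_vec_Abs_hyp) (simp_all add: minkowski_def inner_prod_def power2_eq_square)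
qed

lemma cosh_dist_fermi:
  "cosh (dist (fermi t r) (fermi t' r')) = cosh (t - t') * cosh r * cosh r' - sinh r * sinh r'"
  by (simp add: cosh_dist_hyp hyp_vec_fermi minkowski_def inner_prod_def cosh_diff algebra_simps)

lemma dist_fermi_vertical: "dist (fermi t r) (fermi t r') = \<bar>r - r'\<bar>"
  by (rule dist_hyp_eqI) (simp flip: cosh_dist_hyp add: cosh_dist_fermi cosh_diff)

lemma dist_fermi_horizontal: "dist (fermi t 0) (fermi t' 0) = \<bar>t - t'\<bar>"
  by (rule dist_hyp_eqI) (simp flip: cosh_dist_hyp add: cosh_dist_fermi)

lemma fermi_cases:
  obtains t r where "x = fermi t r"
proof -
  obtain X Y Z where x: "hyp_vec x = ((X, Y), Z)" by (metis prod.exhaust)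
  define r where "r = arsinh Y"
  define t where "t = arsinh (X / cosh r)"
  have XY: "sinh r = Y" "sinh t * cosh r = X" by (simp_all add: r_def t_def)
  have Z: "Z > 0" "Z\<^sup>2 = 1 + (X\<^sup>2 + Y\<^sup>2)"
    using snd_hyp_vec_pos[of x] hyp_vec_snd_square[of x] x by (auto simp: norm_Pair)
  have "(cosh t * cosh r)\<^sup>2 = 1 + ((sinh t * cosh r)\<^sup>2 + (sinh r)\<^sup>2)"
    by (simp add: power_mult_distrib cosh_square_eq algebra_simps)
  then have "(cosh t * cosh r)\<^sup>2 = Z\<^sup>2" using Z XY by simp
  then have "cosh t * cosh r = Z" by (rule power2_eq_imp_eq) (use Z in auto)
  then have "hyp_vec x = hyp_vec (fermi t r)" using x XY by (simp add: hyp_vec_fermi)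
  then show ?thesis using that by (simp add: hyp_vec_inject)
qed

lemma fermi_inject: "fermi t r = fermi t' r' \<longleftrightarrow> t = t' \<and> r = r'"
proof
  assume "fermi t r = fermi t' r'"
  then have "hyp_vec (fermi t r) = hyp_vec (fermi t' r')" by simp
  then show "t = t' \<and> r = r'" by (auto simp: hyp_vec_fermi)
qed simp

definition wall :: "real \<times> real \<Rightarrow> real \<Rightarrow> real" where
  "wall s t = fst s * exp t + snd s * exp (- t)"

text \<open>The two null vectors span, up to sign, the ideal endpoints of the base line and pair
  with \<open>fermi t r\<close> to \<open>cosh r * exp t\<close> and
  \<open>cosh r * exp (- t)\<close>. Hence the line with this normal is the graph
  \<open>tanh r = wall s t\<close>.\<close>

definition wall_normal :: "real \<times> real \<Rightarrow> (real \<times> real) \<times> real" where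
  "wall_normal s = fst s *\<^sub>R ((1, 0), -1) + snd s *\<^sub>R ((-1, 0), -1) - ((0, 1), 0)"

definition wall_region :: "(real \<times> real) set \<Rightarrow> (real \<times> real) hyperbolic_space set" where
  "wall_region S = {x. 0 \<le> minkowski ((0, 1), 0) (hyp_vec x) \<and>
     (\<forall>s\<in>S. 0 \<le> minkowski (wall_normal s) (hyp_vec x))}"

lemma minkowski_fermi:
  "minkowski ((1, 0), -1) (hyp_vec (fermi t r)) = cosh r * exp t"
  "minkowski ((-1, 0), -1) (hyp_vec (fermi t r)) = cosh r * exp (- t)"
  "minkowski ((0, 1), 0) (hyp_vec (fermi t r)) = sinh r"
  by (simp_all add: hyp_vec_fermi minkowski_def inner_prod_def sinh_def cosh_def field_simps)

lemma minkowski_wall_normal: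
  "minkowski (wall_normal s) (hyp_vec (fermi t r)) = cosh r * (wall s t - tanh r)"
  unfolding wall_normal_def minkowski_add_left minkowski_diff_left minkowski_scaleR_left minkowski_fermi
  by (simp add: wall_def tanh_def field_simps)

lemma minkowski_wall_normal_sign:
  "0 \<le> minkowski (wall_normal s) (hyp_vec (fermi t r)) \<longleftrightarrow> tanh r \<le> wall s t"
  "minkowski (wall_normal s) (hyp_vec (fermi t r)) = 0 \<longleftrightarrow> tanh r = wall s t"
  using cosh_real_pos[of r] by (auto simp: minkowski_wall_normal zero_le_mult_iff not_le[symmetric])

lemma fermi_in_wall_region:
  "fermi t r \<in> wall_region S \<longleftrightarrow> 0 \<le> r \<and> (\<forall>s\<in>S. tanh r \<le> wall s t)"
  by (simp add: wall_region_def minkowski_wall_normal_sign minkowski_fermi)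

lemma closed_wall_region: "closed (wall_region S)"
proof -
  have "wall_region S = {x. 0 \<le> minkowski ((0, 1), 0) (hyp_vec x)} \<inter>
      (\<Inter>s\<in>S. {x. 0 \<le> minkowski (wall_normal s) (hyp_vec x)})"
    by (auto simp: wall_region_def)
  then show ?thesis
    by (auto intro!: closed_Int closed_INT closed_Collect_le continuous_intros continuous_on_hyp_vec)
qed

lemma geodesically_convex_wall_region: "geodesically_convex (wall_region S)"
proof -
  have "wall_region S = \<Inter>((\<lambda>n. {x. 0 \<le> minkowski n (hyp_vec x)}) ` insert ((0, 1), 0) (wall_normal ` S))"
    by (auto simp: wall_region_def)
  moreover have "geodesically_convex \<dots>"
    by (rule geodesically_convex_Inter) (use geodesically_convex_halfspace in blast)
  ultimately show ?thesis by simp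
qed

text \<open>A wall has points in the plane only where its value is below 1. Two different walls
  cannot both have points over the same \<open>t\<close>: if they do not meet there, the higher one
  leaves the region. Two walls together with the base line make up the required three boundary
  lines.\<close>

definition admissible_walls :: "(real \<times> real) set \<Rightarrow> bool" where
  "admissible_walls S \<longleftrightarrow>
     (\<forall>s\<in>S. 0 \<le> fst s \<and> 0 \<le> snd s \<and> 0 < fst s + snd s \<and> (\<exists>t. wall s t < 1)) \<and>
     (\<forall>s\<in>S. \<forall>s'\<in>S. \<forall>t. wall s t < 1 \<longrightarrow> wall s' t < 1 \<longrightarrow> s = s') \<and>
     (\<exists>s\<in>S. \<exists>s'\<in>S. s \<noteq> s')"

lemma wall_pos:
  assumes "0 \<le> fst s" "0 \<le> snd s" "0 < fst s + snd s"
  shows "0 < wall s t"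
proof (cases "fst s = 0")
  case True
  then show ?thesis using assms by (simp add: wall_def)
next
  case False
  then show ?thesis using assms unfolding wall_def by (intro add_pos_nonneg) auto
qed

section \<open>Elementary estimates for walls and the hyperbolic tangent\<close>

lemma wall_square_ge: "4 * (fst s * snd s) \<le> (wall s t)\<^sup>2"
proof -
  have e: "exp t * exp (- t) = 1" by (simp flip: exp_add)
  have "(wall s t)\<^sup>2 - 4 * (fst s * snd s) = (fst s * exp t - snd s * exp (- t))\<^sup>2"
    using e unfolding wall_def by algebra
  then show ?thesis by (metis diff_ge_0_iff_ge zero_le_power2)
qed

text \<open>By the inequality of arithmetic and geometric means. The conclusion says that
  \<open>wall_normal s\<close> is spacelike, its square being
  \<open>1 - 4 * (fst s * snd s)\<close>.\<close>

lemma wall_prod_less: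
  assumes "0 \<le> fst s" "0 \<le> snd s" "wall s t < 1"
  shows "4 * (fst s * snd s) < 1"
proof -
  have "0 \<le> wall s t" using assms by (simp add: wall_def)
  then have "(wall s t)\<^sup>2 < 1" using assms by (simp add: power_less_one_iff abs_square_less_1)
  then show ?thesis using wall_square_ge[of s t] by linarith
qed

lemma one_minus_tanh_real: "1 - tanh x = 2 / (exp (2 * x) + 1)" for x :: real
proof -
  have e: "exp (-2 * x) = 1 / exp (2 * x)" by (simp add: exp_minus inverse_eq_divide)
  have "1 - (1 - 1 / E) / (1 + 1 / E) = 2 / (E + 1)" if "E > 0" for E :: real
    using that by (simp add: divide_simps add_pos_pos)
  then show ?thesis unfolding tanh_real_altdef e by simp
qed

lemma tanh_artanh_real:
  assumes "-1 < x" "x < (1::real)"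
  shows "tanh (artanh x) = x"
proof -
  have "exp (2 * artanh x) = (1 + x) / (1 - x)" using assms by (simp add: artanh_def)
  then have "exp (2 * artanh x) + 1 = 2 / (1 - x)" using assms by (simp add: field_simps)
  then have "1 - tanh (artanh x) = 1 - x"
    unfolding one_minus_tanh_real by simp
  then show ?thesis by simp
qed

section \<open>Regions bounded by an admissible family of walls\<close>

context
  fixes S
  assumes S: "admissible_walls S"
begin

lemma wall_nonneg: "s \<in> S \<Longrightarrow> 0 \<le> fst s" "s \<in> S \<Longrightarrow> 0 \<le> snd s"
  and wall_positive: "s \<in> S \<Longrightarrow> 0 < wall s t"
  and wall_active: "s \<in> S \<Longrightarrow> \<exists>t. wall s t < 1"
  and wall_unique: "s \<in> S \<Longrightarrow> s' \<in> S \<Longrightarrow> wall s t < 1 \<Longrightarrow> wall s' t < 1 \<Longrightarrow> s = s'"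
  using S wall_pos unfolding admissible_walls_def by blast+

text \<open>The family may be infinite, yet the infimum of 1 and all values at \<open>t\<close> is
  attained, because at most one value is below 1.\<close>

lemma wall_min: "\<exists>\<eta>\<in>insert 1 ((\<lambda>s. wall s t) ` S). \<forall>s\<in>S. \<eta> \<le> wall s t"
proof (cases "\<exists>s\<in>S. wall s t < 1")
  case True
  then obtain s where s: "s \<in> S" "wall s t < 1" by blast
  then have "\<forall>s'\<in>S. wall s t \<le> wall s' t" using wall_unique by (metis linear not_less order_trans)
  then show ?thesis using s by blast
next
  case False
  then show ?thesis by (auto simp: not_less)
qed

text \<open>With infinitely many walls the strict inequalities do not define an open set at once. As
  the coefficients are nonnegative, lower bounds on the two null products bound all walls from below
  simultaneously, so one neighbourhood serves every \<open>s\<close>.\<close>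

lemma fermi_in_interior_wall_region:
  assumes r: "0 < r" "\<And>s. s \<in> S \<Longrightarrow> tanh r < wall s t"
  shows "fermi t r \<in> interior (wall_region S)"
proof -
  obtain \<eta> where \<eta>: "\<eta> \<in> insert 1 ((\<lambda>s. wall s t) ` S)" "\<And>s. s \<in> S \<Longrightarrow> \<eta> \<le> wall s t"
    using wall_min by blast
  have "tanh r < \<eta>" using \<eta>(1) r tanh_real_lt_1 by auto
  moreover have "0 < tanh r" using r by simp
  \<comment> \<open>The slack between \<open>tanh r\<close> and \<eta> is spent on a factor \<kappa>
    below 1 with \<open>tanh r < \<kappa> * \<eta>\<close>, which lets both null products shrink a
    little.\<close>
  ultimately obtain \<kappa> where \<kappa>: "tanh r / \<eta> < \<kappa>" "\<kappa> < 1"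
    using dense[of "tanh r / \<eta>" 1] by (metis divide_less_eq_1_pos order_less_trans)
  have \<eta>0: "\<eta> > 0" using \<open>tanh r < \<eta>\<close> \<open>0 < tanh r\<close> by linarith
  have \<kappa>0: "0 < \<kappa>" using \<kappa>(1) \<eta>0 \<open>0 < tanh r\<close> by (meson divide_pos_pos less_trans)
  define U :: "(real \<times> real) hyperbolic_space set" where "U = {x. 0 < minkowski ((0, 1), 0) (hyp_vec x) \<and>
      minkowski ((0, 1), 0) (hyp_vec x) < \<kappa> * \<eta> * cosh r \<and>
      \<kappa> * (cosh r * exp t) < minkowski ((1, 0), -1) (hyp_vec x) \<and>
      \<kappa> * (cosh r * exp (- t)) < minkowski ((-1, 0), -1) (hyp_vec x)}"
  have "open U" unfolding U_def
    by (intro open_Collect_conj open_Collect_less continuous_intros continuous_on_hyp_vec)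
  moreover have "fermi t r \<in> U"
  proof -
    have "tanh r < \<kappa> * \<eta>" using \<kappa> \<eta>0 by (simp add: divide_simps)
    then have "tanh r * cosh r < \<kappa> * \<eta> * cosh r" by simp
    then show ?thesis using r \<kappa> by (simp add: U_def minkowski_fermi tanh_def)
  qed
  moreover have "U \<subseteq> wall_region S"
  proof
    fix x assume x: "x \<in> U"
    have "0 \<le> minkowski (wall_normal s) (hyp_vec x)" if s: "s \<in> S" for s
    proof -
      have "minkowski ((0, 1), 0) (hyp_vec x) \<le> \<kappa> * \<eta> * cosh r" using x by (simp add: U_def)
      also have "\<dots> \<le> \<kappa> * wall s t * cosh r" using \<eta>(2)[OF s] \<kappa>0 by simp
      also have "\<dots> = fst s * (\<kappa> * (cosh r * exp t)) + snd s * (\<kappa> * (cosh r * exp (- t)))"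
        by (simp add: wall_def algebra_simps)
      also have "\<dots> \<le> fst s * minkowski ((1, 0), -1) (hyp_vec x) + snd s * minkowski ((-1, 0), -1) (hyp_vec x)"
        using x wall_nonneg[OF s] by (intro add_mono mult_left_mono) (auto simp: U_def)
      finally show ?thesis
        unfolding wall_normal_def minkowski_add_left minkowski_diff_left minkowski_scaleR_left by simp
    qed
    then show "x \<in> wall_region S" using x by (simp add: wall_region_def U_def)
  qed
  ultimately show ?thesis by (rule interiorI)
qed

lemma fermi_on_wall:
  assumes "s \<in> S" "wall s t < 1"
  shows "tanh (artanh (wall s t)) = wall s t" "0 < artanh (wall s t)"
    "fermi t (artanh (wall s t)) \<in> wall_region S"
proof -
  have w: "0 < wall s t" using assms wall_positive by blast
  show t: "tanh (artanh (wall s t)) = wall s t" using w assms by (simp add: tanh_artanh_real)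
  show p: "0 < artanh (wall s t)" using w t by (metis tanh_real_pos_iff)
  have "wall s t \<le> wall s' t" if "s' \<in> S" for s'
    using wall_unique[OF assms(1) that assms(2)] assms(2) by fastforce
  then show "fermi t (artanh (wall s t)) \<in> wall_region S"
    using p by (simp add: fermi_in_wall_region t)
qed

lemma disjoint_walls:
  assumes "s \<in> S"
  shows "s' \<in> S \<Longrightarrow> tanh r = wall s t \<Longrightarrow> tanh r = wall s' t \<Longrightarrow> s = s'"
    and "tanh r = wall s t \<Longrightarrow> r \<noteq> 0"
  using wall_unique[OF assms] wall_positive[OF assms, of t] tanh_real_lt_1[of r] by auto

lemma frontier_wall_region:
  "frontier (wall_region S) = \<Union>(insert {x. minkowski ((0, 1), 0) (hyp_vec x) = 0}
     ((\<lambda>s. {x. minkowski (wall_normal s) (hyp_vec x) = 0}) ` S))"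
proof -
  have "fermi t r \<in> frontier (wall_region S) \<longleftrightarrow> r = 0 \<or> (\<exists>s\<in>S. tanh r = wall s t)" for t r
  proof
    assume fr: "fermi t r \<in> frontier (wall_region S)"
    then have "fermi t r \<in> wall_region S" "fermi t r \<notin> interior (wall_region S)"
      using closed_wall_region by (auto simp: frontier_def)
    then show "r = 0 \<or> (\<exists>s\<in>S. tanh r = wall s t)"
      using fermi_in_interior_wall_region[of r t] unfolding fermi_in_wall_region
      by (metis less_eq_real_def)
  next
    assume on: "r = 0 \<or> (\<exists>s\<in>S. tanh r = wall s t)"
    have in_region: "fermi t r \<in> wall_region S"
    proof (cases "r = 0")
      case True
      then show ?thesis using wall_positive by (auto simp: fermi_in_wall_region less_imp_le)
    next
      case False
      then obtain s where s: "s \<in> S" "tanh r = wall s t" using on by blast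
      then have "wall s t < 1" using tanh_real_lt_1[of r] by simp
      then show ?thesis using fermi_on_wall[OF s(1)] s by (metis artanh_tanh_real)
    qed
    \<comment> \<open>A ball would contain the points half its radius below and above on the same
      vertical. The lower one rules out \<open>r = 0\<close>, the upper one rules out lying on a
      wall.\<close>
    have "fermi t r \<notin> interior (wall_region S)"
    proof
      assume "fermi t r \<in> interior (wall_region S)"
      then obtain \<epsilon> where \<epsilon>: "\<epsilon> > 0" "ball (fermi t r) \<epsilon> \<subseteq> wall_region S"
        by (auto simp: mem_interior)
      then have "fermi t r' \<in> wall_region S" if "\<bar>r - r'\<bar> < \<epsilon>" for r'
        using that by (auto simp: dist_fermi_vertical)
      from this[of "r - \<epsilon> / 2"] this[of "r + \<epsilon> / 2"] \<epsilon>(1)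
      have "0 \<le> r - \<epsilon> / 2" "\<forall>s\<in>S. tanh (r + \<epsilon> / 2) \<le> wall s t"
        by (simp_all add: fermi_in_wall_region)
      moreover have "tanh r < tanh (r + \<epsilon> / 2)" using \<epsilon>(1) by simp
      ultimately show False using on \<epsilon>(1) by (metis diff_ge_0_iff_ge half_gt_zero leD)
    qed
    then show "fermi t r \<in> frontier (wall_region S)"
      using in_region closure_subset by (auto simp: frontier_def)
  qed
  then have "x \<in> frontier (wall_region S) \<longleftrightarrow> minkowski ((0, 1), 0) (hyp_vec x) = 0 \<or>
      (\<exists>s\<in>S. minkowski (wall_normal s) (hyp_vec x) = 0)" for x
    by (cases x rule: fermi_cases) (simp add: minkowski_wall_normal_sign minkowski_fermi)
  then show ?thesis by auto
qed

lemma wall_region_in_convex_class: "wall_region S \<in> convex_class"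
proof -
  define L where "L = {x::(real \<times> real) hyperbolic_space. minkowski ((0, 1), 0) (hyp_vec x) = 0}"
  define W where "W s = {x. minkowski (wall_normal s) (hyp_vec x) = 0}" for s
  have in_L: "fermi t r \<in> L \<longleftrightarrow> r = 0" and in_W: "fermi t r \<in> W s \<longleftrightarrow> tanh r = wall s t" for t r s
    by (simp_all add: L_def W_def minkowski_fermi minkowski_wall_normal_sign)
  have L_line: "hyperplane L"
    unfolding hyperplane_plane_iff_geodesic_line L_def
    by (rule geodesic_line_zero_set[of _ "fermi 0 0"]) (simp_all add: minkowski_fermi, simp add: minkowski_def)
  have W_ne: "\<exists>t. fermi t (artanh (wall s t)) \<in> W s" if s: "s \<in> S" for s
    using wall_active[OF s] fermi_on_wall[OF s] by (auto simp: in_W)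
  have W_line: "hyperplane (W s)" if s: "s \<in> S" for s
  proof -
    obtain t where t: "wall s t < 1" using wall_active[OF s] by blast
    have "minkowski (wall_normal s) (wall_normal s) = 1 - 4 * (fst s * snd s)"
      by (simp add: wall_normal_def minkowski_def inner_prod_def algebra_simps)
    moreover have "4 * (fst s * snd s) < 1"
      using wall_prod_less t wall_nonneg[OF s] by blast
    moreover have "minkowski (wall_normal s) (hyp_vec (fermi t (artanh (wall s t)))) = 0"
      using fermi_on_wall[OF s t] by (simp add: minkowski_wall_normal_sign)
    ultimately show ?thesis
      unfolding hyperplane_plane_iff_geodesic_line W_def by (intro geodesic_line_zero_set) auto
  qed
  have disj_W: "W s \<inter> W s' = {}" if "s \<in> S" "s' \<in> S" "s \<noteq> s'" for s s'
    using disjoint_walls(1)[OF that(1,2)] that(3) in_W by (metis disjoint_iff fermi_cases)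
  have disj_L: "L \<inter> W s = {}" if "s \<in> S" for s
    using disjoint_walls(2)[OF that] in_W in_L by (metis disjoint_iff fermi_cases)
  have disj: "disjoint (insert L (W ` S))"
    unfolding disjoint_def using disj_W disj_L by (auto simp: Int_commute) blast+
  obtain s s' where s: "s \<in> S" "s' \<in> S" "s \<noteq> s'" using S by (auto simp: admissible_walls_def)
  have "W s \<noteq> W s'" "L \<noteq> W s" "L \<noteq> W s'"
    using disj_W[OF s] disj_L s W_ne by blast+
  then have "card {L, W s, W s'} = 3" by simp
  then have three: "\<exists>T\<subseteq>insert L (W ` S). card T = 3" using s by (intro exI[of _ "{L, W s, W s'}"]) auto
  obtain \<eta> where \<eta>: "\<eta> \<in> insert 1 ((\<lambda>s. wall s 0) ` S)" "\<And>s. s \<in> S \<Longrightarrow> \<eta> \<le> wall s 0"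
    using wall_min by blast
  have "\<eta> > 0" using \<eta>(1) wall_positive by auto
  \<comment> \<open>Half of the minimum is strictly below 1 and below every wall at position 0, so
    height \<open>artanh \<theta>\<close> gives an interior point.\<close>
  define \<theta> where "\<theta> = min \<eta> 1 / 2"
  have \<theta>: "0 < \<theta>" "\<theta> < 1" "\<theta> < \<eta>" using \<open>\<eta> > 0\<close> by (auto simp: \<theta>_def)
  have th: "tanh (artanh \<theta>) = \<theta>" using \<theta> by (simp add: tanh_artanh_real)
  then have "0 < artanh \<theta>" using \<theta> by (metis tanh_real_pos_iff)
  then have "fermi 0 (artanh \<theta>) \<in> interior (wall_region S)"
    using \<theta> \<eta>(2) th by (intro fermi_in_interior_wall_region) force+
  then have "interior (wall_region S) \<noteq> {}" by blast
  moreover have "frontier (wall_region S) = \<Union>(insert L (W ` S))"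
    unfolding frontier_wall_region L_def W_def ..
  moreover have "\<forall>P\<in>insert L (W ` S). hyperplane P" using L_line W_line by blast
  ultimately show ?thesis
    unfolding convex_class_def using closed_wall_region geodesically_convex_wall_region disj three by blast
qed

end

section \<open>The stretch\<close>

definition stretch_wall :: "real \<times> real \<Rightarrow> real \<times> real" where
  "stretch_wall s = ((fst s)\<^sup>2 / (1 - 2 * (fst s * snd s)), (snd s)\<^sup>2 / (1 - 2 * (fst s * snd s)))"

text \<open>The stretched wall is the geodesic whose ideal endpoints are the images of those of the
  original wall under \<open>t \<mapsto> 2 * t\<close>: both walls take the value 1 at corresponding points.\<close>

lemma wall_stretch:
  assumes "2 * (fst s * snd s) \<noteq> 1"
  shows "wall (stretch_wall s) (2 * t) = ((wall s t)\<^sup>2 - 2 * (fst s * snd s)) / (1 - 2 * (fst s * snd s))"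
proof -
  have e: "exp t * exp (- t) = 1" "exp (2 * t) = exp t * exp t" "exp (- (2 * t)) = exp (- t) * exp (- t)"
    by (simp_all flip: exp_add)
  have "(wall s t)\<^sup>2 - 2 * (fst s * snd s) = (fst s)\<^sup>2 * exp (2 * t) + (snd s)\<^sup>2 * exp (- (2 * t))"
    using e unfolding wall_def by algebra
  then show ?thesis
    by (simp add: wall_def stretch_wall_def add_divide_distrib)
qed

text \<open>With \<open>k = 2 * (fst s * snd s)\<close>, which lies in [0, 1/2), the value
  \<open>w\<close> becomes \<open>(w\<^sup>2 - k) / (1 - k)\<close>. This map fixes 1, and the gap
  to 1 is multiplied by \<open>(1 + w) / (1 - k)\<close>, which lies between 1 and 4 for
  \<open>w < 1\<close>.\<close>

lemma stretch_wall_bounds: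
  assumes s: "0 \<le> fst s" "0 \<le> snd s" "4 * (fst s * snd s) < 1"
  shows "wall (stretch_wall s) (2 * t) < 1 \<longleftrightarrow> wall s t < 1"
    and "wall s t < 1 \<Longrightarrow> wall (stretch_wall s) (2 * t) \<le> wall s t"
    and "wall s t < 1 \<Longrightarrow> 1 - wall (stretch_wall s) (2 * t) \<le> 4 * (1 - wall s t)"
proof -
  define k where "k = 2 * (fst s * snd s)"
  define w where "w = wall s t"
  have k: "0 \<le> k" "k < 1 / 2" and w: "0 \<le> w" using s by (auto simp: k_def w_def wall_def)
  have st: "wall (stretch_wall s) (2 * t) = (w\<^sup>2 - k) / (1 - k)"
    using wall_stretch[of s t] k unfolding k_def w_def by auto
  show "wall (stretch_wall s) (2 * t) < 1 \<longleftrightarrow> wall s t < 1"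
    using k w by (simp add: st abs_square_less_1 flip: w_def)
  assume "wall s t < 1"
  then have w1: "w < 1" by (simp add: w_def)
  have "(1 - w) * (w + k) \<ge> 0" using w w1 k by simp
  then have "w\<^sup>2 - k \<le> w * (1 - k)" by (simp add: algebra_simps power2_eq_square)
  then show "wall (stretch_wall s) (2 * t) \<le> wall s t"
    using k by (simp add: st divide_simps flip: w_def)
  have "(1 - w) * (4 * (1 - k) - 1 - w) \<ge> 0" using w w1 k by simp
  then have "1 - k - (w\<^sup>2 - k) \<le> 4 * (1 - w) * (1 - k)" by (simp add: algebra_simps power2_eq_square)
  then show "1 - wall (stretch_wall s) (2 * t) \<le> 4 * (1 - wall s t)"
    using k by (simp add: st divide_simps flip: w_def)
qed

text \<open>Since \<open>1 - tanh r\<close> equals \<open>2 / (exp (2 * r) + 1)\<close>, comparable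
  gaps to 1 mean a bounded height difference. The factor grows from 4 to 7 because
  \<open>1 \<le> exp (2 * r')\<close> absorbs the additive constant 3.\<close>

lemma artanh_close:
  assumes "1 - tanh r' \<le> 4 * (1 - tanh r)" "0 \<le> r'"
  shows "r - r' \<le> (ln 7 / 2 :: real)"
proof -
  have pos: "exp (2 * r) + 1 > 0" "exp (2 * r') + 1 > 0" by (simp_all add: add_pos_pos)
  have "exp (2 * r) + 1 \<le> 4 * (exp (2 * r') + 1)"
    using assms(1) pos unfolding one_minus_tanh_real by (simp add: divide_simps)
  moreover have "1 \<le> exp (2 * r')" using assms(2) by simp
  moreover have "E \<le> 7 * E'" if "E + 1 \<le> 4 * (E' + 1)" "1 \<le> E'" for E E' :: real
    using that by simp
  ultimately have "exp (2 * r) \<le> 7 * exp (2 * r')" by blast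
  also have "\<dots> = exp (ln 7 + 2 * r')" by (simp add: exp_add)
  finally show ?thesis by simp
qed

text \<open>Here \<open>cosh d = e * P + g\<close>, and doubling the positions replaces
  \<open>e\<close> by \<open>2 * (e\<^sup>2 + 2 * e)\<close>. That is at least \<open>e\<close>, and
  a termwise comparison with \<open>cosh (2 * d) = 2 * (cosh d)\<^sup>2 - 1\<close>, using
  \<open>P \<ge> 1\<close> and \<open>g \<ge> 1\<close>, gives the upper bound.\<close>

lemma dist_fermi_stretch:
  "dist (fermi t r) (fermi t' r') \<le> dist (fermi (2 * t) r) (fermi (2 * t') r')"
  "dist (fermi (2 * t) r) (fermi (2 * t') r') \<le> 2 * dist (fermi t r) (fermi t' r')"
proof -
  define d D where "d = dist (fermi t r) (fermi t' r')" and "D = dist (fermi (2 * t) r) (fermi (2 * t') r')"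
  define e P g where "e = cosh (t - t') - 1" and "P = cosh r * cosh r'" and "g = cosh (r - r')"
  have ge: "e \<ge> 0" "P \<ge> 1" "g \<ge> 1"
    using cosh_real_ge_1[of r] cosh_real_ge_1[of r'] mult_mono[of 1 "cosh r" 1 "cosh r'"]
    by (simp_all add: e_def P_def g_def cosh_real_ge_1)
  have d: "cosh d = e * P + g"
    by (simp add: d_def e_def P_def g_def cosh_dist_fermi cosh_diff[of r r'] algebra_simps)
  have "cosh (2 * t - 2 * t') = 2 * (cosh (t - t'))\<^sup>2 - 1"
    using cosh_double_cosh[of "t - t'"] by (simp add: algebra_simps)
  then have "cosh D = (2 * (e + 1)\<^sup>2 - 1) * P - sinh r * sinh r'"
    by (simp add: D_def e_def P_def cosh_dist_fermi mult.assoc)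
  then have D: "cosh D = 2 * (e\<^sup>2 + 2 * e) * P + g"
    by (simp add: g_def P_def cosh_diff[of r r'] algebra_simps power2_eq_square)
  have "e * P \<le> 2 * (e\<^sup>2 + 2 * e) * P" using ge by (intro mult_right_mono) auto
  then have "cosh d \<le> cosh D" by (simp add: d D)
  then show "d \<le> D" by (simp add: cosh_real_nonneg_le_iff d_def D_def)
  have "2 * e\<^sup>2 * P \<le> 2 * e\<^sup>2 * P\<^sup>2" "4 * e * P \<le> 4 * e * P * g"
    using ge mult_left_mono[of 1 P "2 * e\<^sup>2 * P"] mult_left_mono[of 1 g "4 * e * P"]
    by (simp_all add: power2_eq_square mult.assoc)
  moreover have "g \<le> 2 * g\<^sup>2 - 1"
  proof -
    have "(2 * g + 1) * (g - 1) \<ge> 0" using ge by simp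
    then show ?thesis by (simp add: algebra_simps power2_eq_square)
  qed
  ultimately have "cosh D \<le> 2 * (e * P + g)\<^sup>2 - 1"
    unfolding D by (simp add: power2_eq_square algebra_simps)
  also have "\<dots> = cosh (2 * d)" by (simp add: cosh_double_cosh d)
  finally show "D \<le> 2 * d" by (simp add: cosh_real_nonneg_le_iff d_def D_def)
qed

text \<open>A stretched wall is below 1 at \<open>t\<close> exactly when the original is at
  \<open>t / 2\<close>. Uniqueness carries over, and so does distinctness, as equal images would be
  below 1 together.\<close>

lemma admissible_stretch_walls:
  assumes S: "admissible_walls S"
  shows "admissible_walls (stretch_wall ` S)"
proof -
  have prod: "4 * (fst s * snd s) < 1" if "s \<in> S" for s
    using wall_active[OF S that] wall_prod_less wall_nonneg[OF S that] by blast
  have active: "wall (stretch_wall s) t < 1 \<longleftrightarrow> wall s (t / 2) < 1" if "s \<in> S" for s t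
    using stretch_wall_bounds(1)[of s "t / 2"] wall_nonneg[OF S that] prod[OF that] by simp
  have "0 \<le> fst (stretch_wall s) \<and> 0 \<le> snd (stretch_wall s) \<and> 0 < fst (stretch_wall s) + snd (stretch_wall s) \<and>
      (\<exists>t. wall (stretch_wall s) t < 1)" if s: "s \<in> S" for s
  proof -
    have "0 < fst s + snd s" using S s by (simp add: admissible_walls_def)
    then have "0 < (fst s)\<^sup>2 + (snd s)\<^sup>2" by (auto simp: sum_power2_gt_zero_iff)
    moreover have "0 < 1 - 2 * (fst s * snd s)" using prod[OF s] wall_nonneg[OF S s] by simp
    moreover obtain t where "wall s t < 1" using wall_active[OF S s] by blast
    then have "wall (stretch_wall s) (2 * t) < 1" using active[OF s, of "2 * t"] by simp
    ultimately show ?thesis by (auto simp: stretch_wall_def simp flip: add_divide_distrib)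
  qed
  moreover have unique: "s = s'"
    if "s \<in> S" "s' \<in> S" "wall (stretch_wall s) t < 1" "wall (stretch_wall s') t < 1" for s s' t
    using wall_unique[OF S] active that by blast
  moreover have "stretch_wall s \<noteq> stretch_wall s'" if "s \<in> S" "s' \<in> S" "s \<noteq> s'" for s s'
    using unique[OF that(1,2)] that calculation(1) by metis
  ultimately show ?thesis
    using S unfolding admissible_walls_def ball_simps bex_simps by (metis (no_types, lifting))
qed

text \<open>The map \<open>f\<close> is the stretch \<open>F\<close> corrected by at most
  \<open>C\<close> to land in the new region. Comparison maps \<open>h\<close> need to preserve
  distances on the region only, which later admits an isometry composed with a change of
  coordinates.\<close>

lemma stretch_quasi_isometry:
  assumes S: "admissible_walls S"
  obtains f where "quasi_isometry (wall_region S) (wall_region (stretch_wall ` S)) f"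
    "\<And>h. distance_preserving_on (wall_region S) h \<Longrightarrow> \<not> finite_distance_on (wall_region S) f h"
proof -
  define C :: real where "C = ln 7 / 2"
  have C: "0 \<le> C" by (simp add: C_def)
  obtain T R where TR: "\<And>x. x = fermi (T x) (R x)" by (metis fermi_cases)
  define F where "F x = fermi (2 * T x) (R x)" for x
  have F: "F (fermi t r) = fermi (2 * t) r" for t r
    using TR[of "fermi t r"] by (simp add: F_def fermi_inject)
  have F_dist: "dist x y \<le> dist (F x) (F y)" "dist (F x) (F y) \<le> 2 * dist x y" for x y
    using dist_fermi_stretch[of "T x" "R x" "T y" "R y"] TR by (simp_all add: F_def)
  note S' = admissible_stretch_walls[OF S]
  have bounds: "wall (stretch_wall s) (2 * t) < 1 \<longleftrightarrow> wall s t < 1"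
      "wall s t < 1 \<Longrightarrow> wall (stretch_wall s) (2 * t) \<le> wall s t"
      "wall s t < 1 \<Longrightarrow> 1 - wall (stretch_wall s) (2 * t) \<le> 4 * (1 - wall s t)" if "s \<in> S" for s t
  proof -
    have "4 * (fst s * snd s) < 1"
      using wall_active[OF S that] wall_prod_less wall_nonneg[OF S that] by blast
    then show "wall (stretch_wall s) (2 * t) < 1 \<longleftrightarrow> wall s t < 1"
      "wall s t < 1 \<Longrightarrow> wall (stretch_wall s) (2 * t) \<le> wall s t"
      "wall s t < 1 \<Longrightarrow> 1 - wall (stretch_wall s) (2 * t) \<le> 4 * (1 - wall s t)"
      using stretch_wall_bounds[of s t] wall_nonneg[OF S that] by blast+
  qed
  \<comment> \<open>If \<open>F x\<close> overshoots, it lies above some stretched wall. Dropping it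
    vertically onto that wall costs at most \<open>C\<close> by \<open>artanh_close\<close>.\<close>
  have near: "\<exists>y\<in>wall_region (stretch_wall ` S). dist y (F x) \<le> C" if x: "x \<in> wall_region S" for x
  proof (cases "F x \<in> wall_region (stretch_wall ` S)")
    case True
    then show ?thesis using C by force
  next
    case False
    define t r where "t = T x" and "r = R x"
    have Fx: "F x = fermi (2 * t) r" by (simp add: F_def t_def r_def)
    have r: "0 \<le> r" "\<And>s. s \<in> S \<Longrightarrow> tanh r \<le> wall s t"
      using x fermi_in_wall_region[of t r S] TR[of x] by (auto simp: t_def r_def)
    then obtain s where s: "s \<in> S" "wall (stretch_wall s) (2 * t) < tanh r"
      using False unfolding Fx fermi_in_wall_region by (auto simp: not_le)
    define w where "w = wall (stretch_wall s) (2 * t)"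
    have w: "w < 1" using s(2) tanh_real_lt_1[of r] by (simp add: w_def)
    note on = fermi_on_wall[OF S' imageI[OF s(1)] w[unfolded w_def], folded w_def]
    have "1 - w \<le> 4 * (1 - wall s t)" using bounds[OF s(1)] w by (simp add: w_def)
    also have "\<dots> \<le> 4 * (1 - tanh r)" using r(2)[OF s(1)] by simp
    finally have "r - artanh w \<le> C"
      unfolding C_def by (intro artanh_close) (use on in auto)
    moreover have "tanh (artanh w) < tanh r" using s(2) on(1) by (simp add: w_def)
    then have "artanh w < r" by simp
    ultimately have "dist (fermi (2 * t) (artanh w)) (F x) \<le> C"
      by (simp add: Fx dist_fermi_vertical)
    then show ?thesis using on(3) by blast
  qed
  have onto: "\<exists>x\<in>wall_region S. F x = y" if y: "y \<in> wall_region (stretch_wall ` S)" for y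
  proof
    define t r where "t = T y / 2" and "r = R y"
    have y': "y = fermi (2 * t) r" using TR[of y] by (simp add: t_def r_def)
    have "tanh r \<le> wall s t" if "s \<in> S" for s
    proof (cases "wall s t < 1")
      case True
      then show ?thesis
        using bounds(2)[OF that True] y that by (force simp: y' fermi_in_wall_region)
    next
      case False
      then show ?thesis using tanh_real_lt_1[of r] by linarith
    qed
    then show "fermi t r \<in> wall_region S" using y by (simp add: y' fermi_in_wall_region)
    show "F (fermi t r) = y" by (simp add: F y')
  qed
  obtain f where f: "\<And>x. x \<in> wall_region S \<Longrightarrow> f x \<in> wall_region (stretch_wall ` S)"
      "\<And>x. x \<in> wall_region S \<Longrightarrow> dist (f x) (F x) \<le> C"
    using near by metis
  have close: "dist (f x) (f y) \<le> dist (F x) (F y) + 2 * C" "dist (F x) (F y) \<le> dist (f x) (f y) + 2 * C"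
    if "x \<in> wall_region S" "y \<in> wall_region S" for x y
    using f(2)[OF that(1)] f(2)[OF that(2)]
      dist_triangle[of "f x" "f y" "F x"] dist_triangle[of "F x" "f y" "F y"]
      dist_triangle[of "F x" "F y" "f x"] dist_triangle[of "f x" "F y" "f y"]
    by (simp_all add: dist_commute)
  have "quasi_isometry (wall_region S) (wall_region (stretch_wall ` S)) f"
  proof -
    have bilip: "1 / 2 * dist x y - 2 * C \<le> dist (f x) (f y) \<and> dist (f x) (f y) \<le> 2 * dist x y + 2 * C"
      if "x \<in> wall_region S" "y \<in> wall_region S" for x y
      using close[OF that] F_dist[of x y] zero_le_dist[of x y] by linarith
    have coarse: "\<exists>x\<in>wall_region S. dist (f x) y \<le> 2 * C" if "y \<in> wall_region (stretch_wall ` S)" for y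
      using onto[OF that] f(2) C by force
    show ?thesis
      unfolding quasi_isometry_def
      by (rule conjI[OF _ exI[of _ 2, OF conjI[OF _ exI[of _ "2 * C", OF conjI]]]])
        (use f(1) C bilip coarse in auto)
  qed
  moreover have "\<not> finite_distance_on (wall_region S) f h"
    if h: "distance_preserving_on (wall_region S) h" for h
  proof
    assume "finite_distance_on (wall_region S) f h"
    then obtain M where M: "\<And>x. x \<in> wall_region S \<Longrightarrow> dist (f x) (h x) \<le> M"
      unfolding finite_distance_on_def bdd_above_def by auto
    \<comment> \<open>Base points \<open>2 * t\<close> apart go to points \<open>4 * t\<close> apart
      under \<open>F\<close>, so closeness of \<open>F\<close>, \<open>f\<close> and
      \<open>h\<close> would give \<open>4 * t \<le> 2 * t + 2 * M + 2 * C\<close>, which this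
      \<open>t\<close> violates.\<close>
    define t where "t = \<bar>M\<bar> + C + 1"
    have base: "fermi u 0 \<in> wall_region S" for u
      using wall_positive[OF S] by (simp add: fermi_in_wall_region less_imp_le)
    let ?a = "fermi (2 * t) 0" and ?b = "fermi 0 0"
    have t: "t > 0" using C by (simp add: t_def add_nonneg_pos)
    have "dist (F ?a) (F ?b) = 4 * t" using t F[of 0 0] by (simp add: F dist_fermi_horizontal)
    moreover have "dist (h ?a) (h ?b) = 2 * t"
      using h base t unfolding distance_preserving_on_def by (simp add: dist_fermi_horizontal)
    ultimately show False
      using close(2)[OF base base, of "2 * t" 0] M[OF base, of "2 * t"] M[OF base, of 0]
        dist_triangle[of "f ?a" "f ?b" "h ?a"] dist_triangle[of "h ?a" "f ?b" "h ?b"] abs_ge_self[of M]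
      by (simp add: t_def dist_commute)
  qed
  ultimately show ?thesis using that by blast
qed

section \<open>Normal form of a convex set\<close>

text \<open>A negative \<open>p\<close> would dominate for large \<open>t\<close>. The witness is
  chosen so that \<open>p * exp (2 * t)\<close> equals \<open>- (\<bar>q\<bar> + 1)\<close>.\<close>

lemma nonneg_of_exp_pos:
  fixes p q :: real
  assumes pos: "\<And>t. 0 < p * exp t + q * exp (- t)"
  shows "0 \<le> p"
proof (rule ccontr)
  assume "\<not> 0 \<le> p"
  then have p: "p < 0" by simp
  define t where "t = ln ((\<bar>q\<bar> + 1) / (- p)) / 2"
  have "(\<bar>q\<bar> + 1) / (- p) > 0" using p by (intro divide_pos_pos) auto
  then have "exp (t + t) = (\<bar>q\<bar> + 1) / (- p)" by (simp add: t_def)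
  then have "exp t * exp t = (\<bar>q\<bar> + 1) / (- p)" by (simp only: exp_add)
  then have "p * (exp t * exp t) = - (\<bar>q\<bar> + 1)" using p by simp
  moreover have "exp t * (p * exp t + q * exp (- t)) = p * (exp t * exp t) + q"
    by (simp add: algebra_simps flip: exp_add)
  moreover have "0 < exp t * (p * exp t + q * exp (- t))" using pos by simp
  ultimately show False by linarith
qed

text \<open>An isometry carries the base line of the Fermi coordinates to a chosen boundary line
  \<open>L\<close>, with \<open>K\<close> on the side of nonnegative \<open>r\<close>. Every other
  boundary line avoids \<open>L\<close> and then becomes a graph over the base line.\<close>

lemma convex_class_normal_form:
  fixes K :: "(real \<times> real) hyperbolic_space set"
  assumes "K \<in> convex_class"
  obtains \<psi> :: "(real \<times> real) hyperbolic_space \<Rightarrow> _" and S where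
    "is_isometry \<psi>" "K = \<psi> ` wall_region S" "admissible_walls S"
proof -
  obtain H Q where K: "closed K" "geodesically_convex K" "interior K \<noteq> {}"
    and H: "\<forall>P\<in>H. geodesic_line P" "disjoint H" "frontier K = \<Union>H" "Q \<subseteq> H" "card Q = 3"
    using assms by (auto simp: convex_class_def hyperplane_plane_iff_geodesic_line)
  obtain L P\<^sub>1 P\<^sub>2 where LP: "L \<in> H" "P\<^sub>1 \<in> H" "P\<^sub>2 \<in> H" "L \<noteq> P\<^sub>1" "L \<noteq> P\<^sub>2" "P\<^sub>1 \<noteq> P\<^sub>2"
    using H(4,5) by (auto simp: card_3_iff)
  obtain N where N: "\<And>P. P \<in> H \<Longrightarrow> P = {x. minkowski (N P) (hyp_vec x) = 0}"
      "K = {x. \<forall>P\<in>H. 0 \<le> minkowski (N P) (hyp_vec x)}"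
    using convex_class_halfplanes[OF K H(3)] H(1) by blast
  have disj: "P \<inter> P' = {}" if "P \<in> H" "P' \<in> H" "P \<noteq> P'" for P P'
    using H(2) that by (simp add: disjoint_def)
  have sub: "P \<subseteq> K" if "P \<in> H" for P
    using that H(3) K(1) by (auto simp: frontier_def)
  have ne: "P \<noteq> {}" if "P \<in> H" for P
    using that H(1) by (auto simp: geodesic_line_def)
  obtain e n p where f: "minkowski_frame e n (hyp_vec p)" "L = {x. minkowski n (hyp_vec x) = 0}"
    and L: "L = range (hyp_ray p e)"
    using geodesic_line_frame H(1) LP(1) by blast
  define c where "c = minkowski (N L) n"
  have e: "minkowski e e = 1" "minkowski e (hyp_vec p) = 0" using f by (auto simp: minkowski_frame_def)
  have on: "minkowski (N L) (hyp_vec (hyp_ray p e s)) = 0" for s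
    using N(1)[OF LP(1)] L by blast
  have "minkowski (N L) (hyp_vec p) = 0" "minkowski (N L) e = 0"
    using on[of 0] on[of 1] by (simp_all add: hyp_vec_ray[OF e] minkowski_simps)
  then have NL: "N L = c *\<^sub>R n"
    using minkowski_frame_expansion[OF f(1), of "N L"] by (simp add: c_def)
  have "c \<noteq> 0"
  proof
    assume "c = 0"
    then have "L = UNIV" using N(1)[OF LP(1)] NL by (auto simp: minkowski_def)
    then show False using disj[of L P\<^sub>1] ne LP by auto
  qed
  \<comment> \<open>The sign turns the unit normal of \<open>L\<close> towards
    \<open>K\<close>.\<close>
  define b where "b = sgn c *\<^sub>R n"
  have fr: "minkowski_frame e b (hyp_vec p)"
    using f(1) \<open>c \<noteq> 0\<close> by (auto simp: minkowski_frame_def b_def minkowski_simps sgn_if)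
  define \<psi> where "\<psi> = frame_map e b (hyp_vec p)"
  have iso: "is_isometry \<psi>" unfolding \<psi>_def by (rule is_isometry_frame_map[OF fr])
  have mink: "minkowski v (hyp_vec (\<psi> (fermi t r))) =
      cosh r * (minkowski v e * sinh t + minkowski v b * tanh r + minkowski v (hyp_vec p) * cosh t)" for v t r
    unfolding \<psi>_def hyp_vec_frame_map[OF fr]
    by (simp add: minkowski_simps hyp_vec_fermi tanh_def field_simps)
  have cases: "\<exists>t r. x = \<psi> (fermi t r)" for x
    using iso unfolding is_isometry_def by (metis fermi_cases surjD)
  have "minkowski (N L) (hyp_vec x) = \<bar>c\<bar> * minkowski b (hyp_vec x)" for x
    unfolding NL b_def minkowski_scaleR_left by (simp flip: mult.assoc add: abs_mult_sgn)
  moreover have "minkowski b (hyp_vec (\<psi> (fermi t r))) = sinh r" for t r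
    unfolding mink using fr by (simp add: minkowski_frame_def minkowski_commute[of b e] tanh_def)
  ultimately have NL': "minkowski (N L) (hyp_vec (\<psi> (fermi t r))) = \<bar>c\<bar> * sinh r" for t r
    by simp
  have in_L: "\<psi> (fermi t r) \<in> L \<longleftrightarrow> r = 0" for t r
  proof -
    have "\<psi> (fermi t r) \<in> L \<longleftrightarrow> minkowski (N L) (hyp_vec (\<psi> (fermi t r))) = 0"
      using N(1)[OF LP(1)] by blast
    then show ?thesis using \<open>c \<noteq> 0\<close> by (simp add: NL')
  qed
  have L_side: "0 \<le> minkowski (N L) (hyp_vec (\<psi> (fermi t r))) \<longleftrightarrow> 0 \<le> r" for t r
    using \<open>c \<noteq> 0\<close> by (simp add: NL' zero_le_mult_iff)
  define fits where "fits P s \<longleftrightarrow> 0 \<le> fst s \<and> 0 \<le> snd s \<and> 0 < fst s + snd s \<and>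
      (\<forall>t r. \<psi> (fermi t r) \<in> P \<longleftrightarrow> tanh r = wall s t) \<and>
      (\<forall>t r. 0 \<le> minkowski (N P) (hyp_vec (\<psi> (fermi t r))) \<longleftrightarrow> tanh r \<le> wall s t) \<and>
      (\<exists>t. wall s t < 1)" for P s
  have "\<exists>s. fits P s" if P: "P \<in> H" "P \<noteq> L" for P
  proof -
    define \<alpha> \<beta> \<gamma> where "\<alpha> = minkowski (N P) e" and "\<beta> = - minkowski (N P) b" and "\<gamma> = minkowski (N P) (hyp_vec p)"
    have NP: "minkowski (N P) (hyp_vec (\<psi> (fermi t r))) = cosh r * (\<alpha> * sinh t + \<gamma> * cosh t - \<beta> * tanh r)" for t r
      by (simp add: mink \<alpha>_def \<beta>_def \<gamma>_def)
    \<comment> \<open>All of \<open>L\<close> lies in \<open>K\<close> and misses \<open>P\<close>,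
      so the half-plane inequality for \<open>P\<close> is strict along \<open>L\<close>.\<close>
    have pos: "0 < \<alpha> * sinh t + \<gamma> * cosh t" for t
    proof -
      have "\<psi> (fermi t 0) \<in> L" by (simp add: in_L)
      then have "\<psi> (fermi t 0) \<in> K" "\<psi> (fermi t 0) \<notin> P" using sub LP disj P by blast+
      then have "0 \<le> minkowski (N P) (hyp_vec (\<psi> (fermi t 0)))" "minkowski (N P) (hyp_vec (\<psi> (fermi t 0))) \<noteq> 0"
        using N P(1) by blast+
      then show ?thesis by (simp add: NP)
    qed
    obtain t\<^sub>0 r\<^sub>0 where tr: "\<psi> (fermi t\<^sub>0 r\<^sub>0) \<in> P" using ne[OF P(1)] cases by (metis ex_in_conv)
    then have "\<psi> (fermi t\<^sub>0 r\<^sub>0) \<in> K" "\<psi> (fermi t\<^sub>0 r\<^sub>0) \<notin> L" using sub P disj LP by blast+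
    then have "0 \<le> r\<^sub>0" "r\<^sub>0 \<noteq> 0" using L_side in_L N(2) LP(1) by blast+
    then have th: "0 < tanh r\<^sub>0" by simp
    have "minkowski (N P) (hyp_vec (\<psi> (fermi t\<^sub>0 r\<^sub>0))) = 0" using tr N(1)[OF P(1)] by blast
    then have eq0: "\<beta> * tanh r\<^sub>0 = \<alpha> * sinh t\<^sub>0 + \<gamma> * cosh t\<^sub>0" by (simp add: NP)
    then have "0 < \<beta> * tanh r\<^sub>0" using pos by simp
    then have \<beta>: "\<beta> > 0" using th by (simp add: zero_less_mult_iff)
    \<comment> \<open>The coefficients come from expanding \<open>sinh t\<close> and
      \<open>cosh t\<close> into exponentials and dividing by \<beta>, which is positive because
      \<open>P\<close> has a point at height \<open>r\<^sub>0 > 0\<close>.\<close>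
    define s where "s = ((\<gamma> + \<alpha>) / (2 * \<beta>), (\<gamma> - \<alpha>) / (2 * \<beta>))"
    have w: "wall s t = (\<alpha> * sinh t + \<gamma> * cosh t) / \<beta>" for t
      using \<beta> by (simp add: wall_def s_def sinh_def cosh_def field_simps)
    have wpos: "0 < wall s t" for t using \<beta> pos by (simp add: w)
    have "0 \<le> fst s" using nonneg_of_exp_pos[of "fst s" "snd s"] wpos by (simp add: wall_def)
    moreover have "0 \<le> snd s"
      using nonneg_of_exp_pos[of "snd s" "fst s"] wpos[of "- t" for t] by (simp add: wall_def add.commute)
    moreover have "0 < fst s + snd s" using wpos[of 0] by (simp add: wall_def)
    moreover have NP': "minkowski (N P) (hyp_vec (\<psi> (fermi t r))) = cosh r * \<beta> * (wall s t - tanh r)" for t r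
      using \<beta> by (simp add: NP w field_simps)
    have "\<psi> (fermi t r) \<in> P \<longleftrightarrow> tanh r = wall s t" for t r
    proof -
      have "\<psi> (fermi t r) \<in> P \<longleftrightarrow> minkowski (N P) (hyp_vec (\<psi> (fermi t r))) = 0"
        using N(1)[OF P(1)] by blast
      then show ?thesis using \<beta> by (auto simp: NP')
    qed
    moreover have "0 \<le> minkowski (N P) (hyp_vec (\<psi> (fermi t r))) \<longleftrightarrow> tanh r \<le> wall s t" for t r
      using mult_le_cancel_left_pos[of "cosh r * \<beta>" 0 "wall s t - tanh r"] \<beta> by (simp add: NP')
    moreover have "wall s t\<^sub>0 < 1" using calculation(4) tr tanh_real_lt_1 by metis
    ultimately show ?thesis unfolding fits_def by blast
  qed
  then obtain \<sigma> where "\<And>P. P \<in> H - {L} \<Longrightarrow> fits P (\<sigma> P)" by (metis DiffE insertI1)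
  then have \<sigma>: "\<And>P. P \<in> H - {L} \<Longrightarrow> 0 \<le> fst (\<sigma> P) \<and> 0 \<le> snd (\<sigma> P) \<and> 0 < fst (\<sigma> P) + snd (\<sigma> P)"
      "\<And>P t r. P \<in> H - {L} \<Longrightarrow> \<psi> (fermi t r) \<in> P \<longleftrightarrow> tanh r = wall (\<sigma> P) t"
      "\<And>P t r. P \<in> H - {L} \<Longrightarrow> 0 \<le> minkowski (N P) (hyp_vec (\<psi> (fermi t r))) \<longleftrightarrow> tanh r \<le> wall (\<sigma> P) t"
      "\<And>P. P \<in> H - {L} \<Longrightarrow> \<exists>t. wall (\<sigma> P) t < 1"
    unfolding fits_def by blast+
  define S where "S = \<sigma> ` (H - {L})"
  have in_K: "\<psi> (fermi t r) \<in> K \<longleftrightarrow> fermi t r \<in> wall_region S" for t r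
    using LP(1) L_side[of t r] \<sigma>(3)[of _ t r] unfolding N(2) fermi_in_wall_region S_def by auto
  then have "K = \<psi> ` wall_region S"
    by (auto simp: image_iff) (metis cases, metis fermi_cases)
  moreover have "admissible_walls S"
    unfolding admissible_walls_def
  proof (intro conjI)
    \<comment> \<open>The point of \<open>P'\<close> over \<open>t\<close> lies in \<open>K\<close>,
      hence not above the wall of \<open>P\<close>. With the assumed inequality it lies on
      \<open>P\<close> too, which disjointness allows only if the lines coincide.\<close>
    have le: "P = P'" if "P \<in> H - {L}" "P' \<in> H - {L}" "wall (\<sigma> P) t \<le> wall (\<sigma> P') t" "wall (\<sigma> P') t < 1"
      for P P' t
    proof (rule ccontr)
      assume "P \<noteq> P'"
      define r where "r = artanh (wall (\<sigma> P') t)"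
      have "0 < wall (\<sigma> P') t" using \<sigma>(1)[OF that(2)] by (intro wall_pos) auto
      then have r: "tanh r = wall (\<sigma> P') t" using that by (simp add: r_def tanh_artanh_real)
      then have in_P': "\<psi> (fermi t r) \<in> P'" using \<sigma>(2) that by blast
      then have "tanh r \<le> wall (\<sigma> P) t" using sub that \<sigma>(3) N(2) by blast
      then have "\<psi> (fermi t r) \<in> P" using \<sigma>(2) that r by simp
      then show False using in_P' disj \<open>P \<noteq> P'\<close> that by blast
    qed
    show "\<forall>s\<in>S. \<forall>s'\<in>S. \<forall>t. wall s t < 1 \<longrightarrow> wall s' t < 1 \<longrightarrow> s = s'"
    proof (clarsimp simp: S_def)
      fix P P' t assume "P \<in> H" "P \<noteq> L" "P' \<in> H" "P' \<noteq> L" "wall (\<sigma> P) t < 1" "wall (\<sigma> P') t < 1"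
      then have "P = P'" using le[of P P' t] le[of P' P t] by fastforce
      then show "\<sigma> P = \<sigma> P'" by simp
    qed
    show "\<forall>s\<in>S. 0 \<le> fst s \<and> 0 \<le> snd s \<and> 0 < fst s + snd s \<and> (\<exists>t. wall s t < 1)"
      using \<sigma>(1,4) by (auto simp: S_def)
    have "\<sigma> P\<^sub>1 \<noteq> \<sigma> P\<^sub>2"
    proof
      assume eq: "\<sigma> P\<^sub>1 = \<sigma> P\<^sub>2"
      have P: "P\<^sub>1 \<in> H - {L}" "P\<^sub>2 \<in> H - {L}" using LP by auto
      obtain t where "wall (\<sigma> P\<^sub>2) t < 1" using \<sigma>(4)[OF P(2)] by blast
      then have "P\<^sub>1 = P\<^sub>2" using le[OF P, of t] eq by simp
      then show False using LP(6) by contradiction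
    qed
    then show "\<exists>s\<in>S. \<exists>s'\<in>S. s \<noteq> s'" using LP by (auto simp: S_def)
  qed
  ultimately show ?thesis using that iso by blast
qed

section \<open>Transfer from the normal form to an arbitrary \<open>K\<close>\<close>

theorem theorem9p2:
  fixes K :: "(real \<times> real) hyperbolic_space set"
  assumes "K \<in> convex_class"
  shows "\<not> rigid K"
proof
  assume rigid: "rigid K"
  obtain \<psi> :: "(real \<times> real) hyperbolic_space \<Rightarrow> (real \<times> real) hyperbolic_space" and S
    where \<psi>: "is_isometry \<psi>" "K = \<psi> ` wall_region S" and S: "admissible_walls S"
    using convex_class_normal_form[OF assms] by blast
  obtain f where f: "quasi_isometry (wall_region S) (wall_region (stretch_wall ` S)) f"
    and far: "\<And>h. distance_preserving_on (wall_region S) h \<Longrightarrow> \<not> finite_distance_on (wall_region S) f h"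
    using stretch_quasi_isometry[OF S] by blast
  have \<psi>_dist: "dist (\<psi> x) (\<psi> y) = dist x y" for x y
    using \<psi>(1) by (simp add: is_isometry_def distance_preserving_on_def)
  have "inj \<psi>" by (rule injI) (metis \<psi>_dist dist_eq_0_iff)
  \<comment> \<open>Precomposing with the inverse of \<psi> moves the domain from the region to
    \<open>K\<close>. Conversely, an isometry \<open>g\<close> near this map makes
    \<open>g \<circ> \<psi>\<close> a distance-preserving map near \<open>f\<close>, which
    \<open>far\<close> excludes.\<close>
  have "quasi_isometry K (wall_region (stretch_wall ` S)) (f \<circ> inv \<psi>)"
    using f unfolding quasi_isometry_def \<psi>(2)
    by (simp add: Pi_iff inv_f_f[OF \<open>inj \<psi>\<close>] \<psi>_dist)
  then obtain g :: "(real \<times> real) hyperbolic_space \<Rightarrow> (real \<times> real) hyperbolic_space"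
    where g: "is_isometry g" "finite_distance_on K (f \<circ> inv \<psi>) g"
    using rigid wall_region_in_convex_class[OF admissible_stretch_walls[OF S]]
    unfolding rigid_def by blast
  have "distance_preserving_on (wall_region S) (g \<circ> \<psi>)"
    using g(1) by (simp add: is_isometry_def distance_preserving_on_def \<psi>_dist)
  moreover have "finite_distance_on (wall_region S) f (g \<circ> \<psi>)"
    using g(2) by (simp add: finite_distance_on_def \<psi>(2) image_image inv_f_f[OF \<open>inj \<psi>\<close>])
  ultimately show False using far by blast
qed

end
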